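(* Let $G$ be an antiferromagnetic weighted graph and let $\mathcal{K}$ be the class of all complete graphs. If $H$ is a $\mathcal{K}$-blow-up of a bipartite graph $F$, then \[ \hom(H,G)^2\le \hom(H\times K_2,G). \]
   Context: A weighted graph $G$ on a finite vertex set is given by a symmetric function $G:V(G)\times V(G)\to\mathbb{R}_{\ge 0}$ (equivalently a symmetric nonnegative matrix); loops (positive diagonal entries) are allowed. $G$ is antiferromagnetic if this symmetric matrix has at most one positive eigenvalue, counted with multiplicity. For a graph $H$, $\hom(H,G)=\sum_{\phi:V(H)\to V(G)}\prod_{uv\in E(H)}G(\phi(u),\phi(v))$. The tensor product $H\times K_2$ has vertex set $V(H)\times\{1,2\}$, with $(u,i)$ adjacent to $(v,j)$ iff $uv\in E(H)$ and $i\ne j$. For a class $\mathcal{H}$ of graphs and a graph $F$ on vertices $v_1,\dots,v_k$, an $\mathcal{H}$-blow-up of $F$ is obtained by choosing $H_1,\dots,H_k\in\mathcal{H}$, taking their disjoint union, and adding all edges between $V(H_i)$ and $V(H_j)$ whenever $v_iv_j\in E(F)$. *)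

theory Defs
  imports "HOL-Library.FuncSet" "Jordan_Normal_Form.Char_Poly"
begin

definition weight_matrix :: "nat \<Rightarrow> (nat \<Rightarrow> nat \<Rightarrow> real) \<Rightarrow> real mat" where
  "weight_matrix n W = mat n n (\<lambda>(i,j). W i j)"

definition weighted_graph :: "nat \<Rightarrow> (nat \<Rightarrow> nat \<Rightarrow> real) \<Rightarrow> bool" where
  "weighted_graph n W \<longleftrightarrow> (\<forall>i<n. \<forall>j<n. W i j = W j i \<and> W i j \<ge> 0)"

definition num_pos_eigenvalues :: "real mat \<Rightarrow> nat" where
  "num_pos_eigenvalues A = (\<Sum>a\<in>{a. a > 0 \<and> eigenvalue A a}. order a (char_poly A))"

definition antiferromagnetic :: "nat \<Rightarrow> (nat \<Rightarrow> nat \<Rightarrow> real) \<Rightarrow> bool" where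
  "antiferromagnetic n W \<longleftrightarrow> weighted_graph n W \<and> num_pos_eigenvalues (weight_matrix n W) \<le> 1"

definition simple_graph :: "'a set \<Rightarrow> ('a \<Rightarrow> 'a \<Rightarrow> bool) \<Rightarrow> bool" where
  "simple_graph V adj \<longleftrightarrow> finite V \<and>
     (\<forall>u v. adj u v \<longrightarrow> u \<in> V \<and> v \<in> V \<and> u \<noteq> v \<and> adj v u)"

definition edges :: "'a set \<Rightarrow> ('a \<Rightarrow> 'a \<Rightarrow> bool) \<Rightarrow> 'a set set" where
  "edges V adj = {{u, v} | u v. u \<in> V \<and> v \<in> V \<and> adj u v}"

(* weight of the image of the edge e under phi; the orientation is irrelevant as W is symmetric *)
definition edge_weight :: "(nat \<Rightarrow> nat \<Rightarrow> real) \<Rightarrow> ('a \<Rightarrow> nat) \<Rightarrow> 'a set \<Rightarrow> real" where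
  "edge_weight W \<phi> e = (let (u, v) = (SOME (u, v). e = {u, v}) in W (\<phi> u) (\<phi> v))"

definition hom :: "'a set \<Rightarrow> ('a \<Rightarrow> 'a \<Rightarrow> bool) \<Rightarrow> nat \<Rightarrow> (nat \<Rightarrow> nat \<Rightarrow> real) \<Rightarrow> real" where
  "hom V adj n W = (\<Sum>\<phi> \<in> V \<rightarrow>\<^sub>E {0..<n}. \<Prod>e \<in> edges V adj. edge_weight W \<phi> e)"

definition tensor_K2_verts :: "'a set \<Rightarrow> ('a \<times> bool) set" where
  "tensor_K2_verts V = V \<times> (UNIV :: bool set)"

definition tensor_K2_adj :: "('a \<Rightarrow> 'a \<Rightarrow> bool) \<Rightarrow> 'a \<times> bool \<Rightarrow> 'a \<times> bool \<Rightarrow> bool" where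
  "tensor_K2_adj adj x y \<longleftrightarrow> adj (fst x) (fst y) \<and> snd x \<noteq> snd y"

definition bipartite :: "'a set \<Rightarrow> ('a \<Rightarrow> 'a \<Rightarrow> bool) \<Rightarrow> bool" where
  "bipartite V adj \<longleftrightarrow> (\<exists>A \<subseteq> V. \<forall>u v. adj u v \<longrightarrow> (u \<in> A \<longleftrightarrow> v \<notin> A))"

definition complete_blowup :: "'f set \<Rightarrow> ('f \<Rightarrow> 'f \<Rightarrow> bool) \<Rightarrow> 'a set \<Rightarrow> ('a \<Rightarrow> 'a \<Rightarrow> bool) \<Rightarrow> bool" where
  "complete_blowup VF AF V adj \<longleftrightarrow>
     (\<exists>p. p \<in> V \<rightarrow> VF \<and> (\<forall>i \<in> VF. \<exists>u \<in> V. p u = i) \<and>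
          (\<forall>u \<in> V. \<forall>v \<in> V. adj u v \<longleftrightarrow> ((p u = p v \<and> u \<noteq> v) \<or> AF (p u) (p v))))"

end

theory Submission
  imports Defs "HOL-Analysis.Function_Topology"
begin

text \<open>A map of \<open>H \<times> K\<^sub>2\<close> is a pair of maps of \<open>H\<close>; in \<open>hom(H,G)\<^sup>2\<close> every edge is \<^emph>\<open>straight\<close>
  (it joins equal coordinates of the pairs), in \<open>hom(H \<times> K\<^sub>2,G)\<close> every edge is \<^emph>\<open>crossed\<close>. Swapping the
  coordinates on one side of the bipartition of \<open>F\<close> crosses all edges between different cliques for
  free. The cliques are then crossed one at a time; with everything outside a clique fixed, its vertices
  carry weights \<open>a\<close> and \<open>b\<close>, and one needs \<open>p(a,\<dots>,a) p(b,\<dots>,b) \<le> hom\<^sub>a\<^sub>,\<^sub>b(K\<^sub>q \<times> K\<^sub>2)\<close>, where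
  \<open>p(c\<^sub>1,\<dots>,c\<^sub>q)\<close> counts maps of \<open>K\<^sub>q\<close> with weight \<open>c\<^sub>i\<close> on vertex \<open>i\<close>. Conditioning on one matched pair of
  vertices reduces this by induction to \<open>p(a,\<dots>,a) p(b,\<dots>,b) \<le> p(b,a,\<dots>,a) p(a,b,\<dots>,b)\<close>, a consequence of
  the Alexandrov--Fenchel inequality \<open>p(x,x,c) p(y,y,c) \<le> p(x,y,c)\<^sup>2\<close>. The latter holds for \<open>q = 2\<close> because \<open>G\<close>
  has at most one positive eigenvalue, and propagates to all \<open>q\<close> by the Bochner method.\<close>

section \<open>Symmetric matrices\<close>

definition bform :: "nat \<Rightarrow> (nat \<Rightarrow> nat \<Rightarrow> real) \<Rightarrow> (nat \<Rightarrow> real) \<Rightarrow> (nat \<Rightarrow> real) \<Rightarrow> real" where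
  "bform n A x y = (\<Sum>i<n. \<Sum>j<n. x i * A i j * y j)"

definition mvec :: "nat \<Rightarrow> (nat \<Rightarrow> nat \<Rightarrow> real) \<Rightarrow> (nat \<Rightarrow> real) \<Rightarrow> nat \<Rightarrow> real" where
  "mvec n A x i = (\<Sum>j<n. A i j * x j)"

definition wdot :: "nat \<Rightarrow> (nat \<Rightarrow> real) \<Rightarrow> (nat \<Rightarrow> real) \<Rightarrow> (nat \<Rightarrow> real) \<Rightarrow> real" where
  "wdot n d x y = (\<Sum>i<n. d i * x i * y i)"

text \<open>A spectrum-free consequence, for nonnegative symmetric matrices, of having at most one
  positive eigenvalue. Testing only against positive \<open>y\<close> lets the property pass through
  a substitution that preserves positivity.\<close>

definition lorentzian :: "nat \<Rightarrow> (nat \<Rightarrow> nat \<Rightarrow> real) \<Rightarrow> bool" where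
  "lorentzian n A \<longleftrightarrow>
     (\<forall>x y. (\<forall>i<n. 0 < y i) \<longrightarrow> bform n A x x * bform n A y y \<le> (bform n A x y)\<^sup>2)"

lemma bform_mvec: "bform n A x y = (\<Sum>i<n. x i * mvec n A y i)"
  by (simp add: bform_def mvec_def sum_distrib_left mult.assoc)

lemma bform_commute:
  assumes "\<And>i j. i < n \<Longrightarrow> j < n \<Longrightarrow> A i j = A j i"
  shows "bform n A x y = bform n A y x"
proof -
  have "bform n A x y = (\<Sum>j<n. \<Sum>i<n. x i * A i j * y j)"
    unfolding bform_def by (rule sum.swap)
  also have "\<dots> = bform n A y x"
    unfolding bform_def using assms by (intro sum.cong) auto
  finally show ?thesis .
qed

lemma bform_add_left: "bform n A (\<lambda>i. s * x i + t * y i) z = s * bform n A x z + t * bform n A y z"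
  by (simp add: bform_mvec sum.distrib sum_distrib_left algebra_simps)

lemma mvec_add: "mvec n A (\<lambda>i. s * x i + t * y i) k = s * mvec n A x k + t * mvec n A y k"
  by (simp add: mvec_def sum.distrib sum_distrib_left algebra_simps)

lemma bform_add_right: "bform n A z (\<lambda>i. s * x i + t * y i) = s * bform n A z x + t * bform n A z y"
  by (simp add: bform_mvec mvec_add sum.distrib sum_distrib_left algebra_simps)

lemma wdot_add_left: "wdot n d (\<lambda>i. s * x i + t * y i) z = s * wdot n d x z + t * wdot n d y z"
  by (simp add: wdot_def sum.distrib sum_distrib_left algebra_simps)

lemma wdot_commute: "wdot n d x y = wdot n d y x"
  by (simp add: wdot_def algebra_simps)

lemma wdot_add_right: "wdot n d z (\<lambda>i. s * x i + t * y i) = s * wdot n d z x + t * wdot n d z y"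
  by (simp add: wdot_def sum.distrib sum_distrib_left algebra_simps)

lemma wdot_nonneg: "(\<And>i. i < n \<Longrightarrow> 0 < d i) \<Longrightarrow> 0 \<le> wdot n d x x"
  unfolding wdot_def by (intro sum_nonneg) (simp add: mult.assoc less_imp_le)

lemma wdot_self_eq_0D:
  assumes d: "\<And>i. i < n \<Longrightarrow> 0 < d i" and "wdot n d x x = 0" and "i < n"
  shows "x i = 0"
proof -
  have "(\<Sum>i<n. d i * x i * x i) = 0" using assms by (simp add: wdot_def)
  moreover have "\<And>i. i < n \<Longrightarrow> 0 \<le> d i * x i * x i"
    using d by (simp add: mult.assoc less_imp_le)
  ultimately have "d i * x i * x i = 0"
    using \<open>i < n\<close> by (subst (asm) sum_nonneg_eq_0_iff) auto
  with d[OF \<open>i < n\<close>] show ?thesis by auto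
qed

text \<open>If the form is nonpositive on the orthogonal complement of \<open>w\<close>, then the
  span of \<open>x\<close> and \<open>y\<close> meets that complement, so the form cannot be positive
  definite on the span; the conclusion is the sign of the discriminant.\<close>

lemma reverse_cauchy_schwarz:
  assumes sym: "\<And>i j. i < n \<Longrightarrow> j < n \<Longrightarrow> A i j = A j i"
    and neg: "\<And>z. bform n A z w = 0 \<Longrightarrow> bform n A z z \<le> 0"
    and y: "0 \<le> bform n A y y"
  shows "bform n A x x * bform n A y y \<le> (bform n A x y)\<^sup>2"
proof (cases "bform n A y y = 0")
  case True
  then show ?thesis by simp
next
  case False
  with y have yy: "0 < bform n A y y" by simp
  define s where "s = bform n A y w"
  define t where "t = - bform n A x w"
  have s: "s \<noteq> 0" using neg[of y] yy by (auto simp: s_def)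
  let ?z = "\<lambda>i. s * x i + t * y i"
  have "bform n A ?z w = 0" unfolding bform_add_left by (simp add: s_def t_def)
  then have "bform n A ?z ?z \<le> 0" by (rule neg)
  then have "s * s * bform n A x x + 2 * s * t * bform n A x y + t * t * bform n A y y \<le> 0"
    using bform_commute[of n A x y, OF sym]
    by (simp add: bform_add_left bform_add_right algebra_simps)
  \<comment> \<open>Multiplying by the positive number \<open>bform n A y y\<close> allows the
    square in \<open>t\<close> to be completed; what remains is the square of \<open>s\<close> times
    the discriminant.\<close>
  then have "bform n A y y * (s * s * bform n A x x + 2 * s * t * bform n A x y + t * t * bform n A y y) \<le> 0"
    using yy by (simp add: mult_nonneg_nonpos)
  then have "(t * bform n A y y + s * bform n A x y)\<^sup>2
      + s\<^sup>2 * (bform n A x x * bform n A y y - (bform n A x y)\<^sup>2) \<le> 0"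
    by (simp add: power2_eq_square algebra_simps)
  then have "s\<^sup>2 * (bform n A x x * bform n A y y - (bform n A x y)\<^sup>2) \<le> 0"
    by (smt (verit) zero_le_power2)
  with s show ?thesis by (simp add: mult_le_0_iff)
qed

section \<open>Eigenvectors by constrained maximisation\<close>

lemma linear_term_eq_0:
  fixes b c :: real
  assumes "\<And>t. 0 \<le> 2 * t * b + t * t * c"
  shows "b = 0"
proof (rule ccontr)
  assume b: "b \<noteq> 0"
  \<comment> \<open>Any \<open>C\<close> that is positive and exceeds \<open>c\<close> works: at
    \<open>t = - b / C\<close> the negative linear term outweighs the quadratic one.\<close>
  define C where "C = \<bar>c\<bar> + 1"
  have C: "0 < C" "c < C" by (auto simp: C_def)
  have "2 * (- b / C) * b + (- b / C) * (- b / C) * c = (b * b / C) * (c / C - 2)"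
    using C by (simp add: field_simps)
  moreover have "c / C - 2 < 0" using C by (simp add: field_simps)
  moreover have "0 < b * b / C" using b C by (intro divide_pos_pos) (auto simp: zero_less_mult_iff)
  ultimately have "2 * (- b / C) * b + (- b / C) * (- b / C) * c < 0"
    by (metis mult_pos_neg)
  with assms[of "- b / C"] show False by simp
qed

text \<open>With D the diagonal matrix of \<open>d\<close>, the form is maximised over the
  \<open>wdot n d\<close> unit sphere in the complement of \<open>T\<close>. Since \<open>T\<close>
  consists of solutions of A u = c D u, this complement is invariant under the inverse of D times A,
  so the maximiser satisfies the eigenvalue equation without extra multipliers for the constraints.
  The last conclusion lets a test vector \<open>x0\<close> bound the eigenvalue from below.\<close>

lemma exists_constrained_eigenvector:
  fixes A :: "nat \<Rightarrow> nat \<Rightarrow> real"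
  assumes sym: "\<And>i j. i < n \<Longrightarrow> j < n \<Longrightarrow> A i j = A j i"
    and d: "\<And>i. i < n \<Longrightarrow> 0 < d i"
    and T: "\<And>u. u \<in> T \<Longrightarrow> \<exists>c. \<forall>i<n. mvec n A u i = c * d i * u i"
    and x0: "\<And>u. u \<in> T \<Longrightarrow> wdot n d x0 u = 0" and x0_pos: "0 < wdot n d x0 x0"
  obtains v \<mu> where "wdot n d v v = 1" "\<And>u. u \<in> T \<Longrightarrow> wdot n d v u = 0"
    "\<And>i. i < n \<Longrightarrow> mvec n A v i = \<mu> * d i * v i"
    "bform n A x0 x0 \<le> \<mu> * wdot n d x0 x0"
proof -
  \<comment> \<open>Vectors are functions on all of \<open>nat\<close>. Pinning the coordinates from
    \<open>n\<close> on to 0 and bounding the others as the unit sphere does turns the feasible set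
    into a closed subset of a product of compact sets.\<close>
  define B where "B i = (if i < n then {- (1 / sqrt (d i)) .. 1 / sqrt (d i)} else {0})" for i
  define K where "K = (Pi\<^sub>E UNIV B) \<inter> {x. wdot n d x x = 1} \<inter> (\<Inter>u\<in>T. {x. wdot n d x u = 0})"
  have coord: "continuous_on UNIV (\<lambda>x :: nat \<Rightarrow> real. x i)" for i
    by (rule continuous_on_product_coordinates)
  have "compact (B i)" for i by (simp add: B_def)
  then have "compactin (product_topology (\<lambda>_. euclidean) UNIV) (Pi\<^sub>E UNIV B)"
    by (subst compactin_PiE) auto
  then have "compact (Pi\<^sub>E UNIV B)"
    by (simp add: euclidean_product_topology)
  moreover have "closed {x. wdot n d x x = 1}" "\<And>u. closed {x. wdot n d x u = 0}"
    unfolding wdot_def by (intro closed_Collect_eq continuous_intros coord)+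
  ultimately have "compact K"
    unfolding K_def by (intro compact_Int_closed closed_INT) auto
  have in_K: "\<exists>y\<in>K. \<forall>i<n. y i = x i / sqrt (wdot n d x x)"
    if "0 < wdot n d x x" and orth: "\<And>u. u \<in> T \<Longrightarrow> wdot n d x u = 0" for x
  proof -
    define r where "r = sqrt (wdot n d x x)"
    have r: "0 < r" "r * r = wdot n d x x" using that by (auto simp: r_def)
    define y where "y i = (if i < n then x i / r else 0)" for i
    have yu: "wdot n d y u = wdot n d x u / r" for u
      unfolding wdot_def y_def by (simp add: sum_divide_distrib)
    have yy: "wdot n d y y = 1"
    proof -
      have "wdot n d y y = wdot n d x y / r" by (rule yu)
      also have "wdot n d x y = wdot n d x x / r" using yu[of x] by (simp add: wdot_commute)
      finally show ?thesis using r(1) by (simp add: r(2)[symmetric])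
    qed
    have "y i \<in> B i" for i
    proof (cases "i < n")
      case True
      have "d i * y i * y i \<le> wdot n d y y"
        unfolding wdot_def using d True
        by (intro member_le_sum) (auto simp: mult.assoc less_imp_le)
      then have "(y i)\<^sup>2 \<le> 1 / d i" using yy d[OF True] by (simp add: field_simps power2_eq_square)
      then have "\<bar>y i\<bar> \<le> sqrt (1 / d i)" by (metis real_sqrt_abs real_sqrt_le_mono)
      then show ?thesis using True by (auto simp: B_def real_sqrt_divide)
    qed (simp add: B_def y_def)
    then have "y \<in> K" using yy yu orth by (auto simp: K_def)
    then show ?thesis by (intro bexI[of _ y]) (auto simp: y_def r_def)
  qed
  have "K \<noteq> {}" using in_K[OF x0_pos x0] by auto
  have "continuous_on K (\<lambda>x. bform n A x x)"
    unfolding bform_def by (intro continuous_intros continuous_on_subset[OF coord]) auto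
  from continuous_attains_sup[OF \<open>compact K\<close> \<open>K \<noteq> {}\<close> this]
  obtain v where v: "v \<in> K" and max: "\<And>x. x \<in> K \<Longrightarrow> bform n A x x \<le> bform n A v v" by auto
  define \<mu> where "\<mu> = bform n A v v"
  have vv: "wdot n d v v = 1" and vu: "\<And>u. u \<in> T \<Longrightarrow> wdot n d v u = 0"
    using v by (auto simp: K_def)
  have bound: "bform n A x x \<le> \<mu> * wdot n d x x" if orth: "\<And>u. u \<in> T \<Longrightarrow> wdot n d x u = 0" for x
  proof (cases "wdot n d x x = 0")
    case True
    then have "\<And>i. i < n \<Longrightarrow> x i = 0" using wdot_self_eq_0D[of n d x, OF d] by blast
    then have "bform n A x x = 0" by (simp add: bform_def)
    with True show ?thesis by simp
  next
    case False
    then have pos: "0 < wdot n d x x" using wdot_nonneg[of n d x, OF d] by simp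
    obtain y where y: "y \<in> K" "\<forall>i<n. y i = x i / sqrt (wdot n d x x)"
      using in_K[OF pos orth] by blast
    have "bform n A y y = (\<Sum>i<n. \<Sum>j<n. x i * A i j * x j / wdot n d x x)"
      unfolding bform_def using y(2) pos by (intro sum.cong) auto
    also have "\<dots> = bform n A x x / wdot n d x x"
      by (simp add: bform_def sum_divide_distrib)
    finally have "bform n A x x / wdot n d x x \<le> \<mu>" using max[OF y(1)] by (simp add: \<mu>_def)
    then show ?thesis using pos by (simp add: field_simps)
  qed
  \<comment> \<open>The residual of the eigenvalue equation is itself orthogonal to
    \<open>T\<close>, hence an admissible direction of variation. The first-order condition in that
    direction says that the norm of \<open>z\<close> is 0.\<close>
  define z where "z i = mvec n A v i / d i - \<mu> * v i" for i
  have Av_dot: "wdot n d (\<lambda>i. mvec n A v i / d i) x = bform n A v x" for x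
  proof -
    have "wdot n d (\<lambda>i. mvec n A v i / d i) x = bform n A x v"
      unfolding wdot_def bform_mvec using d by (intro sum.cong) (auto simp: less_imp_neq[THEN not_sym] dest!: d)
    then show ?thesis using bform_commute[of n A x v, OF sym] by simp
  qed
  have z_dot: "wdot n d z x = bform n A v x - \<mu> * wdot n d v x" for x
    using wdot_add_left[of n d 1 "\<lambda>i. mvec n A v i / d i" "-\<mu>" v x] by (simp add: z_def[abs_def] Av_dot)
  have zu: "wdot n d z u = 0" if u: "u \<in> T" for u
  proof -
    obtain c where c: "\<forall>i<n. mvec n A u i = c * d i * u i" using T[OF u] by blast
    have "bform n A v u = c * wdot n d v u"
      unfolding bform_mvec wdot_def sum_distrib_left using c by (intro sum.cong) auto
    then show ?thesis using vu[OF u] by (simp add: z_dot)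
  qed
  have "0 \<le> 2 * t * (\<mu> * wdot n d v z - bform n A v z) + t * t * (\<mu> * wdot n d z z - bform n A z z)" for t
  proof -
    let ?y = "\<lambda>i. 1 * v i + t * z i"
    have "bform n A ?y ?y \<le> \<mu> * wdot n d ?y ?y"
      by (intro bound, unfold wdot_add_left) (simp add: vu zu)
    then show ?thesis
      using bform_commute[of n A z v, OF sym] wdot_commute[of n d z v] vv
      unfolding wdot_add_left wdot_add_right bform_add_left bform_add_right
      by (simp add: \<mu>_def[symmetric] algebra_simps)
  qed
  then have "\<mu> * wdot n d v z - bform n A v z = 0" by (rule linear_term_eq_0)
  then have "wdot n d z z = 0" by (simp add: z_dot)
  then have "z i = 0" if "i < n" for i using wdot_self_eq_0D[of n d z, OF d] that by blast
  then have "mvec n A v i = \<mu> * d i * v i" if "i < n" for i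
    using d[OF that] \<open>\<And>i. i < n \<Longrightarrow> z i = 0\<close>[OF that] by (simp add: z_def field_simps)
  with that[OF vv vu] bound[OF x0] show thesis by blast
qed

section \<open>Spectral decomposition\<close>

text \<open>The eigenvectors are found one by one, each in the complement of its predecessors. That
  complement is nonzero because the orthogonal projection onto it has trace \<open>n - m\<close>,
  which is positive.\<close>

lemma exists_orthonormal_eigenvectors:
  fixes A :: "nat \<Rightarrow> nat \<Rightarrow> real"
  assumes sym: "\<And>i j. i < n \<Longrightarrow> j < n \<Longrightarrow> A i j = A j i" and "m \<le> n"
  shows "\<exists>u ev. (\<forall>k<m. \<forall>l<m. wdot n (\<lambda>_. 1) (u k) (u l) = (if k = l then 1 else 0))
    \<and> (\<forall>k<m. \<forall>i<n. mvec n A (u k) i = ev k * u k i)"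
  using \<open>m \<le> n\<close>
proof (induction m)
  case (Suc m)
  let ?dot = "wdot n (\<lambda>_. 1)"
  obtain u ev where orth: "\<And>k l. k < m \<Longrightarrow> l < m \<Longrightarrow> ?dot (u k) (u l) = (if k = l then 1 else 0)"
    and eig: "\<And>k i. k < m \<Longrightarrow> i < n \<Longrightarrow> mvec n A (u k) i = ev k * u k i"
    using Suc.IH Suc_leD[OF Suc.prems] by blast
  \<comment> \<open>\<open>x j\<close> is the projection of the \<open>j\<close>-th unit vector onto
    the complement. Its squared norm is the diagonal entry \<open>x j j\<close>, so a positive trace
    yields a nonzero projected vector.\<close>
  define x where "x j i = (if i = j then 1 else 0) - (\<Sum>k<m. u k j * u k i)" for j i
  have dot_x: "?dot (x j) y = y j - (\<Sum>k<m. u k j * ?dot (u k) y)" if "j < n" for j y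
  proof -
    have "?dot (x j) y = (\<Sum>i<n. (if i = j then y i else 0)) - (\<Sum>i<n. \<Sum>k<m. u k j * (u k i * y i))"
      unfolding wdot_def x_def sum_subtractf[symmetric]
      by (intro sum.cong) (auto simp: algebra_simps sum_distrib_left sum_distrib_right)
    also have "(\<Sum>i<n. \<Sum>k<m. u k j * (u k i * y i)) = (\<Sum>k<m. u k j * ?dot (u k) y)"
      by (subst sum.swap) (simp add: wdot_def sum_distrib_left)
    finally show ?thesis using that by simp
  qed
  have orth_x: "?dot (x j) (u l) = 0" if "j < n" "l < m" for j l
  proof -
    have "(\<Sum>k<m. u k j * ?dot (u k) (u l)) = (\<Sum>k<m. if k = l then u k j else 0)"
      using orth that by (intro sum.cong) auto
    then show ?thesis using that by (simp add: dot_x)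
  qed
  have self_x: "?dot (x j) (x j) = x j j" if "j < n" for j
    using dot_x[OF that, of "x j"] orth_x[OF that] by (simp add: wdot_commute)
  have "(\<Sum>j<n. x j j) = real n - (\<Sum>k<m. ?dot (u k) (u k))"
    unfolding x_def sum_subtractf by (subst sum.swap) (simp add: wdot_def)
  also have "\<dots> = real n - real m" using orth by simp
  finally have "0 < (\<Sum>j<n. x j j)" using Suc.prems by simp
  then obtain j where j: "j < n" "0 < x j j"
    using sum_nonpos[of "{..<n}" "\<lambda>j. x j j"] by (force simp: not_less)
  obtain v \<mu> where v: "?dot v v = 1" "\<And>w. w \<in> u ` {..<m} \<Longrightarrow> ?dot v w = 0"
    "\<And>i. i < n \<Longrightarrow> mvec n A v i = \<mu> * 1 * v i"
  proof (rule exists_constrained_eigenvector[of n A "\<lambda>_. 1" "u ` {..<m}" "x j"])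
    show "\<exists>c. \<forall>i<n. mvec n A w i = c * 1 * w i" if "w \<in> u ` {..<m}" for w
      using that eig by auto
  qed (use sym orth_x self_x j in auto)
  have v': "?dot v (u k) = 0" "?dot (u k) v = 0" if "k < m" for k
    using v(2)[of "u k"] wdot_commute[of n _ v "u k"] that by auto
  show ?case
    by (rule exI[of _ "u(m := v)"], rule exI[of _ "ev(m := \<mu>)"])
      (use orth eig v v' in \<open>auto simp: less_Suc_eq\<close>)
qed simp

text \<open>The matrix with columns \<open>u k\<close> is orthogonal and diagonalises
  \<open>A\<close>. The characteristic polynomial is recorded as well because
  \<open>num_pos_eigenvalues\<close> counts algebraic multiplicities.\<close>

theorem symmetric_spectral_decomposition:
  fixes A :: "nat \<Rightarrow> nat \<Rightarrow> real"
  assumes sym: "\<And>i j. i < n \<Longrightarrow> j < n \<Longrightarrow> A i j = A j i"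
  obtains u ev where "\<And>i j. i < n \<Longrightarrow> j < n \<Longrightarrow> A i j = (\<Sum>k<n. ev k * u k i * u k j)"
    "\<And>k l. k < n \<Longrightarrow> l < n \<Longrightarrow> wdot n (\<lambda>_. 1) (u k) (u l) = (if k = l then 1 else 0)"
    "char_poly (weight_matrix n A) = (\<Prod>k<n. [:- ev k, 1:])"
proof -
  obtain u ev where orth: "\<And>k l. k < n \<Longrightarrow> l < n \<Longrightarrow> wdot n (\<lambda>_. 1) (u k) (u l) = (if k = l then 1 else 0)"
    and eig: "\<And>k i. k < n \<Longrightarrow> i < n \<Longrightarrow> mvec n A (u k) i = ev k * u k i"
    using exists_orthonormal_eigenvectors[of n A n] sym by blast
  define M where "M = weight_matrix n A"
  define U where "U = mat n n (\<lambda>(i, k). u k i)"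
  define D where "D = mat n n (\<lambda>(i, k). if i = k then ev k else 0)"
  have carr: "M \<in> carrier_mat n n" "U \<in> carrier_mat n n" "D \<in> carrier_mat n n" "transpose_mat U \<in> carrier_mat n n"
    by (auto simp: M_def U_def D_def weight_matrix_def)
  have "transpose_mat U * U = 1\<^sub>m n"
  proof (rule eq_matI)
    fix i j assume "i < dim_row (1\<^sub>m n :: real mat)" "j < dim_col (1\<^sub>m n :: real mat)"
    then have ij: "i < n" "j < n" by auto
    then have "(transpose_mat U * U) $$ (i, j) = wdot n (\<lambda>_. 1) (u i) (u j)"
      by (simp add: U_def scalar_prod_def wdot_def atLeast0LessThan)
    then show "(transpose_mat U * U) $$ (i, j) = 1\<^sub>m n $$ (i, j)" using orth ij by simp
  qed (auto simp: U_def)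
  then have UUt: "U * transpose_mat U = 1\<^sub>m n"
    using mat_mult_left_right_inverse carr by blast
  have UD: "(U * D) $$ (i, k) = ev k * u k i" if "i < n" "k < n" for i k
  proof -
    have "(U * D) $$ (i, k) = (\<Sum>l<n. if l = k then ev k * u k i else 0)"
      using that by (simp add: U_def D_def scalar_prod_def atLeast0LessThan if_distrib mult.commute cong: if_cong)
    then show ?thesis using that by simp
  qed
  have "M * U = U * D"
  proof (rule eq_matI)
    fix i k assume "i < dim_row (U * D)" "k < dim_col (U * D)"
    then have ik: "i < n" "k < n" using carr by auto
    then have "(M * U) $$ (i, k) = mvec n A (u k) i"
      by (simp add: M_def U_def weight_matrix_def scalar_prod_def mvec_def atLeast0LessThan)
    then show "(M * U) $$ (i, k) = (U * D) $$ (i, k)" using eig UD ik by simp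
  qed (use carr in auto)
  have MUDU: "M = U * D * transpose_mat U"
  proof -
    have "M = M * (U * transpose_mat U)" using UUt carr by simp
    also have "\<dots> = (M * U) * transpose_mat U" using carr by (intro assoc_mult_mat[symmetric])
    finally show ?thesis using \<open>M * U = U * D\<close> by simp
  qed
  have "similar_mat_wit M D U (transpose_mat U)"
    using carr UUt \<open>transpose_mat U * U = 1\<^sub>m n\<close> MUDU by (intro similar_mat_witI)
  then have "char_poly M = char_poly D"
    by (intro char_poly_similar) (auto simp: similar_mat_def)
  also have "\<dots> = (\<Prod>a\<leftarrow>diag_mat D. [:- a, 1:])"
    by (intro char_poly_upper_triangular[of _ n]) (auto simp: D_def upper_triangular_def)
  also have "diag_mat D = map ev [0..<n]"
    by (auto simp: diag_mat_def D_def)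
  also have "(\<Prod>a\<leftarrow>map ev [0..<n]. [:- a, 1:]) = (\<Prod>k<n. [:- ev k, 1:])"
    by (simp add: o_def prod.distinct_set_conv_list[symmetric] atLeast0LessThan)
  finally have cp: "char_poly (weight_matrix n A) = (\<Prod>k<n. [:- ev k, 1:])" by (simp add: M_def)
  have "A i j = (\<Sum>k<n. ev k * u k i * u k j)" if "i < n" "j < n" for i j
  proof -
    have "A i j = (U * D * transpose_mat U) $$ (i, j)"
      using that unfolding MUDU[symmetric] by (simp add: M_def weight_matrix_def)
    also have "\<dots> = (\<Sum>k<n. (U * D) $$ (i, k) * u k j)"
      using that carr by (simp add: scalar_prod_def atLeast0LessThan U_def)
    also have "\<dots> = (\<Sum>k<n. ev k * u k i * u k j)"
      using UD that by (intro sum.cong) auto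
    finally show ?thesis .
  qed
  with that orth cp show thesis by blast
qed

lemma order_prod_linear:
  fixes ev :: "'i \<Rightarrow> 'a :: field"
  assumes "finite I"
  shows "order a (\<Prod>k\<in>I. [:- ev k, 1:]) = card {k\<in>I. ev k = a}"
  using assms
proof (induction I rule: finite_induct)
  case (insert i I)
  have "(\<Prod>k\<in>insert i I. [:- ev k, 1:]) \<noteq> 0"
    using insert.hyps by (subst prod_zero_iff) auto
  then have "order a (\<Prod>k\<in>insert i I. [:- ev k, 1:])
      = order a [:- ev i, 1:] + card {k\<in>I. ev k = a}"
    using insert by (simp add: order_mult del: mult_pCons_left mult_pCons_right)
  also have "\<dots> = card {k\<in>insert i I. ev k = a}"
  proof (cases "ev i = a")
    case True
    then have "{k\<in>insert i I. ev k = a} = insert i {k\<in>I. ev k = a}" by auto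
    then show ?thesis using insert True by (simp add: order_linear')
  next
    case False
    then have "{k\<in>insert i I. ev k = a} = {k\<in>I. ev k = a}" by auto
    then show ?thesis using False by (simp add: order_linear')
  qed
  finally show ?case .
qed (simp add: order_0I)

lemma num_pos_eigenvalues_eq_card:
  assumes "M \<in> carrier_mat n n" and cp: "char_poly M = (\<Prod>k<n. [:- ev k, 1:])"
  shows "num_pos_eigenvalues M = card {k. k < n \<and> 0 < ev k}"
proof -
  let ?P = "{k. k < n \<and> 0 < ev k}"
  have "eigenvalue M a \<longleftrightarrow> (\<exists>k<n. ev k = a)" for a
    unfolding eigenvalue_root_char_poly[OF assms(1)] cp by (auto simp: poly_prod)
  then have "{a. a > 0 \<and> eigenvalue M a} = ev ` ?P" by auto
  then have "num_pos_eigenvalues M = (\<Sum>a\<in>ev ` ?P. card {k\<in>{..<n}. ev k = a})"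
    by (simp add: num_pos_eigenvalues_def cp order_prod_linear)
  also have "\<dots> = (\<Sum>a\<in>ev ` ?P. \<Sum>k\<in>{k\<in>?P. ev k = a}. 1)"
    by (intro sum.cong) (auto intro!: arg_cong[where f = card])
  also have "\<dots> = (\<Sum>k\<in>?P. 1)"
    by (rule sum.image_gen[symmetric]) simp
  finally show ?thesis by simp
qed

text \<open>In an orthonormal eigenbasis the form is diagonal with at most one positive coefficient.
  Orthogonality to that eigenvector removes the positive term, which is the situation of
  \<open>reverse_cauchy_schwarz\<close>.\<close>

lemma antiferromagnetic_imp_lorentzian:
  assumes "antiferromagnetic n W"
  shows "lorentzian n W"
proof -
  have sym: "W i j = W j i" and nonneg: "0 \<le> W i j" if "i < n" "j < n" for i j
    using assms that by (auto simp: antiferromagnetic_def weighted_graph_def)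
  obtain u ev where W: "\<And>i j. i < n \<Longrightarrow> j < n \<Longrightarrow> W i j = (\<Sum>k<n. ev k * u k i * u k j)"
    and orth: "\<And>k l. k < n \<Longrightarrow> l < n \<Longrightarrow> wdot n (\<lambda>_. 1) (u k) (u l) = (if k = l then 1 else 0)"
    and cp: "char_poly (weight_matrix n W) = (\<Prod>k<n. [:- ev k, 1:])"
  proof (rule symmetric_spectral_decomposition[of n W])
    show "\<And>i j. i < n \<Longrightarrow> j < n \<Longrightarrow> W i j = W j i" by (rule sym)
  qed (rule that; assumption)
  have form: "bform n W x y = (\<Sum>k<n. ev k * wdot n (\<lambda>_. 1) x (u k) * wdot n (\<lambda>_. 1) y (u k))" for x y
  proof -
    have "bform n W x y = (\<Sum>i<n. \<Sum>j<n. \<Sum>k<n. ev k * (x i * u k i) * (y j * u k j))"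
      unfolding bform_def by (intro sum.cong refl) (simp add: W sum_distrib_left sum_distrib_right mult_ac)
    also have "\<dots> = (\<Sum>i<n. \<Sum>k<n. \<Sum>j<n. ev k * (x i * u k i) * (y j * u k j))"
      by (intro sum.cong refl sum.swap)
    also have "\<dots> = (\<Sum>k<n. \<Sum>i<n. \<Sum>j<n. ev k * (x i * u k i) * (y j * u k j))"
      by (rule sum.swap)
    also have "\<dots> = (\<Sum>k<n. ev k * wdot n (\<lambda>_. 1) x (u k) * wdot n (\<lambda>_. 1) y (u k))"
      by (simp add: wdot_def sum_distrib_left sum_distrib_right mult_ac)
    finally show ?thesis .
  qed
  let ?P = "{k. k < n \<and> 0 < ev k}"
  have "card ?P \<le> 1"
    using assms num_pos_eigenvalues_eq_card[OF _ cp]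
    by (simp add: antiferromagnetic_def weight_matrix_def)
  then obtain k0 where k0: "\<And>k. k < n \<Longrightarrow> k \<noteq> k0 \<Longrightarrow> ev k \<le> 0"
    by (subst (asm) card_le_Suc0_iff_eq[unfolded One_nat_def[symmetric]]) (auto simp: not_less[symmetric], metis+)
  \<comment> \<open>If no eigenvalue is positive, \<open>w = 0\<close> makes the orthogonality
    condition vacuous, and the form is nonpositive everywhere.\<close>
  define w where "w = (if k0 < n \<and> 0 < ev k0 then u k0 else (\<lambda>_. 0))"
  have neg: "bform n W z z \<le> 0" if z: "bform n W z w = 0" for z
    unfolding form
  proof (intro sum_nonpos)
    fix k assume "k \<in> {..<n}"
    then have k: "k < n" by simp
    show "ev k * wdot n (\<lambda>_. 1) z (u k) * wdot n (\<lambda>_. 1) z (u k) \<le> 0"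
    proof (cases "0 < ev k")
      case True
      then have "k = k0" using k0 k by force
      then have "bform n W z (u k) = 0" using z True k by (simp add: w_def)
      moreover have "bform n W z (u k) = (\<Sum>l<n. if l = k then ev k * wdot n (\<lambda>_. 1) z (u k) else 0)"
        unfolding form using orth k by (intro sum.cong) auto
      ultimately show ?thesis using k by auto
    next
      case False
      then show ?thesis by (simp add: mult.assoc mult_nonpos_nonneg)
    qed
  qed
  show ?thesis
    unfolding lorentzian_def
  proof (intro allI impI)
    fix x y assume y: "\<forall>i<n. 0 < (y i :: real)"
    have "0 \<le> bform n W y y"
      unfolding bform_def using y nonneg by (intro sum_nonneg) (auto simp: less_imp_le)
    then show "bform n W x x * bform n W y y \<le> (bform n W x y)\<^sup>2"
      using sym neg by (intro reverse_cauchy_schwarz[where w = w]) auto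
  qed
qed

section \<open>The Alexandrov--Fenchel inequality for cliques\<close>

text \<open>Let D be diagonal with entries \<open>mvec n A w i / w i\<close>, so that A w = D w. For
  A v = m D v the Bochner inequality reads m <= m^2, so every positive eigenvalue is at least 1. A
  Perron--Frobenius argument shows that eigenvalues at least 1 do not occur orthogonally to the
  positive eigenvector \<open>w\<close>, so the form is nonpositive there.\<close>

lemma lorentzian_of_bochner:
  fixes A :: "nat \<Rightarrow> nat \<Rightarrow> real"
  assumes sym: "\<And>i j. i < n \<Longrightarrow> j < n \<Longrightarrow> A i j = A j i"
    and pos: "\<And>i j. i < n \<Longrightarrow> j < n \<Longrightarrow> 0 < A i j"
    and w: "\<And>i. i < n \<Longrightarrow> 0 < w i"
    and bochner: "\<And>x. bform n A x x \<le> (\<Sum>i<n. w i * (mvec n A x i)\<^sup>2 / mvec n A w i)"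
  shows "lorentzian n A"
proof -
  define d where "d i = mvec n A w i / w i" for i
  have Aw: "0 < mvec n A w i" if "i < n" for i
    unfolding mvec_def using that pos w by (intro sum_pos) auto
  have d: "0 < d i" if "i < n" for i using Aw w that by (simp add: d_def)
  have dw: "d i * w i = mvec n A w i" if "i < n" for i using w[OF that] by (simp add: d_def)
  have neg: "bform n A z z \<le> 0" if zw: "bform n A z w = 0" for z
  proof (rule ccontr)
    assume "\<not> bform n A z z \<le> 0"
    then have zz: "0 < bform n A z z" by simp
    have "wdot n d z w = bform n A z w"
      unfolding wdot_def bform_mvec using dw by (intro sum.cong) (auto simp: mult_ac)
    then have zw0: "wdot n d z w = 0" using zw by simp
    have "wdot n d z z \<noteq> 0"
    proof
      assume "wdot n d z z = 0"
      then have "z i = 0" if "i < n" for i using wdot_self_eq_0D[of n d z, OF d] that by blast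
      then have "bform n A z z = 0" by (simp add: bform_def)
      with zz show False by simp
    qed
    then have zz': "0 < wdot n d z z" using wdot_nonneg[of n d z, OF d] by simp
    \<comment> \<open>A vector orthogonal to \<open>w\<close> with positive form value forces an
      eigenvector orthogonal to \<open>w\<close> with positive eigenvalue.\<close>
    obtain v \<mu> where vv: "wdot n d v v = 1" and vw: "wdot n d v w = 0"
      and eig: "\<And>i. i < n \<Longrightarrow> mvec n A v i = \<mu> * d i * v i"
      and le: "bform n A z z \<le> \<mu> * wdot n d z z"
    proof (rule exists_constrained_eigenvector[of n A d "{w}" z])
      show "\<exists>c. \<forall>i<n. mvec n A u i = c * d i * u i" if "u \<in> {w}" for u
        using that dw by (intro exI[of _ 1]) auto
    qed (use sym d zw0 zz' in auto)
    have \<mu>: "0 < \<mu>" using zz zz' le by (smt (verit) mult_nonpos_nonneg)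
    have bvv: "bform n A v v = \<mu>"
    proof -
      have "bform n A v v = \<mu> * wdot n d v v"
        unfolding bform_mvec wdot_def sum_distrib_left using eig by (intro sum.cong) auto
      then show ?thesis using vv by simp
    qed
    have "(\<Sum>i<n. w i * (mvec n A v i)\<^sup>2 / mvec n A w i) = \<mu>\<^sup>2 * wdot n d v v"
      unfolding wdot_def sum_distrib_left
    proof (intro sum.cong refl)
      fix i assume "i \<in> {..<n}"
      then have i: "i < n" by simp
      show "w i * (mvec n A v i)\<^sup>2 / mvec n A w i = \<mu>\<^sup>2 * (d i * v i * v i)"
        unfolding eig[OF i] dw[OF i, symmetric] using d[OF i] w[OF i]
        by (simp add: field_simps power2_eq_square)
    qed
    with bochner[of v] have "\<mu> \<le> \<mu>\<^sup>2" using bvv vv by simp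
    with \<mu> have \<mu>1: "1 \<le> \<mu>" by (simp add: power2_eq_square)
    \<comment> \<open>The Dirichlet form of \<open>v / w\<close>: its nonnegative terms add up to 2
      (1 - \<mu>) <= 0, so they all vanish. As \<open>A\<close> is positive, \<open>v / w\<close> is
      constant, and orthogonality to \<open>w\<close> then forces \<open>v = 0\<close>.\<close>
    let ?t = "\<lambda>i j. A i j * w i * w j * (v i / w i - v j / w j)\<^sup>2"
    have half: "(\<Sum>i<n. \<Sum>j<n. A i j * w j * (v i)\<^sup>2 / w i) = wdot n d v v"
      unfolding wdot_def
    proof (intro sum.cong refl)
      fix i assume "i \<in> {..<n}"
      have "(\<Sum>j<n. A i j * w j * (v i)\<^sup>2 / w i) = mvec n A w i * ((v i)\<^sup>2 / w i)"
        unfolding mvec_def sum_distrib_right by simp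
      then show "(\<Sum>j<n. A i j * w j * (v i)\<^sup>2 / w i) = d i * v i * v i"
        by (simp add: d_def power2_eq_square)
    qed
    have half': "(\<Sum>i<n. \<Sum>j<n. A i j * w i * (v j)\<^sup>2 / w j) = wdot n d v v"
    proof -
      have "(\<Sum>i<n. \<Sum>j<n. A i j * w i * (v j)\<^sup>2 / w j) = (\<Sum>j<n. \<Sum>i<n. A i j * w i * (v j)\<^sup>2 / w j)"
        by (rule sum.swap)
      also have "\<dots> = (\<Sum>j<n. \<Sum>i<n. A j i * w i * (v j)\<^sup>2 / w j)"
        using sym by (intro sum.cong) auto
      finally show ?thesis using half by simp
    qed
    have "(\<Sum>i<n. \<Sum>j<n. ?t i j)
        = (\<Sum>i<n. \<Sum>j<n. A i j * w j * (v i)\<^sup>2 / w i + A i j * w i * (v j)\<^sup>2 / w j - 2 * (v i * A i j * v j))"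
    proof (intro sum.cong refl)
      fix i j assume "i \<in> {..<n}" "j \<in> {..<n}"
      then show "?t i j = A i j * w j * (v i)\<^sup>2 / w i + A i j * w i * (v j)\<^sup>2 / w j - 2 * (v i * A i j * v j)"
        using w[of i] w[of j] by (simp add: field_simps power2_eq_square)
    qed
    also have "\<dots> = 2 * wdot n d v v - 2 * bform n A v v"
      by (simp add: sum.distrib sum_subtractf half half' bform_def sum_distrib_left)
    finally have "(\<Sum>i<n. \<Sum>j<n. ?t i j) \<le> 0" using bvv vv \<mu>1 by simp
    moreover have t0: "0 \<le> ?t i j" if "i < n" "j < n" for i j
      using that pos w by (intro mult_nonneg_nonneg) (auto simp: less_imp_le)
    ultimately have "(\<Sum>i<n. \<Sum>j<n. ?t i j) = 0"
      by (intro antisym sum_nonneg) auto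
    then have tz: "?t i j = 0" if "i < n" "j < n" for i j
    proof -
      have "(\<Sum>j<n. ?t i j) = 0"
        using \<open>(\<Sum>i<n. \<Sum>j<n. ?t i j) = 0\<close> that t0
        by (subst (asm) sum_nonneg_eq_0_iff) (auto intro!: sum_nonneg simp del: mult_eq_0_iff)
      then show ?thesis
        using that t0 by (subst (asm) sum_nonneg_eq_0_iff) (auto simp del: mult_eq_0_iff)
    qed
    have parallel: "v i * w j = v j * w i" if "i < n" "j < n" for i j
    proof -
      have "A i j * w i * w j \<noteq> 0"
        using pos[OF that] w[OF that(1)] w[OF that(2)] by simp
      then have "v i / w i = v j / w j" using tz[OF that] by auto
      then show ?thesis using w[OF that(1)] w[OF that(2)] by (simp add: field_simps)
    qed
    have "v j = 0" if j: "j < n" for j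
    proof -
      have "v j * wdot n d w w = w j * wdot n d v w"
        unfolding wdot_def sum_distrib_left using parallel j by (intro sum.cong) auto
      moreover have "wdot n d w w \<noteq> 0"
        using wdot_self_eq_0D[of n d w j, OF d] w[OF j] j by force
      ultimately show ?thesis using vw by simp
    qed
    then have "wdot n d v v = 0" by (simp add: wdot_def)
    with vv show False by simp
  qed
  show ?thesis
    unfolding lorentzian_def
  proof (intro allI impI)
    fix x y assume y: "\<forall>i<n. 0 < (y i :: real)"
    have "0 \<le> bform n A y y"
      unfolding bform_def using y pos by (intro sum_nonneg) (auto simp: less_imp_le)
    then show "bform n A x x * bform n A y y \<le> (bform n A x y)\<^sup>2"
      using sym neg by (intro reverse_cauchy_schwarz[where w = w]) auto
  qed
qed

text \<open>The weighted count of maps of a complete graph, one weight per vertex. Revealing the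
  image of the first vertex absorbs its edges into the other weights, so conditioning on a vertex
  produces a form of the same kind.\<close>

function clique_form :: "nat \<Rightarrow> (nat \<Rightarrow> nat \<Rightarrow> real) \<Rightarrow> (nat \<Rightarrow> real) list \<Rightarrow> real" where
  "clique_form n W [] = 1"
| "clique_form n W (c # cs) = (\<Sum>z<n. c z * clique_form n W (map (\<lambda>d y. d y * W z y) cs))"
  by pat_completeness auto
termination by (relation "inv_image less_than (\<lambda>(n, W, cs). length cs)") auto

text \<open>Log-concavity makes the ratios of consecutive values nonincreasing, and the last ratio
  is compared with the first. The induction is written without division.\<close>

lemma log_concave_ends:
  fixes f :: "nat \<Rightarrow> real"
  assumes pos: "\<And>k. k \<le> m \<Longrightarrow> 0 < f k"
    and lc: "\<And>k. Suc (Suc k) \<le> m \<Longrightarrow> f k * f (Suc (Suc k)) \<le> (f (Suc k))\<^sup>2"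
    and "Suc j \<le> m"
  shows "f 0 * f (Suc j) \<le> f 1 * f j"
  using \<open>Suc j \<le> m\<close>
proof (induction j)
  case (Suc j)
  have "f j * (f 0 * f (Suc (Suc j))) = f 0 * (f j * f (Suc (Suc j)))" by simp
  also have "\<dots> \<le> f 0 * (f (Suc j))\<^sup>2"
    using lc[of j] pos[of 0] Suc.prems by (intro mult_left_mono) auto
  also have "\<dots> = (f 0 * f (Suc j)) * f (Suc j)" by (simp add: power2_eq_square)
  also have "\<dots> \<le> (f 1 * f j) * f (Suc j)"
    using Suc pos[of "Suc j"] by (intro mult_right_mono) auto
  also have "\<dots> = f j * (f 1 * f (Suc j))" by simp
  finally show ?case using pos[of j] Suc.prems by simp
qed simp

text \<open>The recursion of \<open>clique_form\<close> for one weight shared by all vertices, but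
  with an arbitrary kernel, so that it also covers maps into pairs.\<close>

primrec clique_sum :: "'z set \<Rightarrow> ('z \<Rightarrow> 'z \<Rightarrow> real) \<Rightarrow> nat \<Rightarrow> ('z \<Rightarrow> real) \<Rightarrow> real" where
  "clique_sum Y k 0 \<gamma> = 1"
| "clique_sum Y k (Suc q) \<gamma> = (\<Sum>z\<in>Y. \<gamma> z * clique_sum Y k q (\<lambda>z'. \<gamma> z' * k z z'))"

lemma clique_form_replicate: "clique_form n W (replicate q a) = clique_sum {..<n} W q a"
  by (induction q arbitrary: a) (auto simp: map_replicate)

definition straight :: "(nat \<Rightarrow> nat \<Rightarrow> real) \<Rightarrow> nat \<times> nat \<Rightarrow> nat \<times> nat \<Rightarrow> real" where
  "straight W z z' = W (fst z) (fst z') * W (snd z) (snd z')"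

definition crossed :: "(nat \<Rightarrow> nat \<Rightarrow> real) \<Rightarrow> nat \<times> nat \<Rightarrow> nat \<times> nat \<Rightarrow> real" where
  "crossed W z z' = W (fst z) (snd z') * W (snd z) (fst z')"

text \<open>Straight edges never mix the two coordinates, so the coordinates vary
  independently.\<close>

lemma clique_sum_straight:
  "clique_sum (Y \<times> Y) (straight W) q (\<lambda>z. a (fst z) * b (snd z)) = clique_sum Y W q a * clique_sum Y W q b"
proof (induction q arbitrary: a b)
  case (Suc q)
  have "(\<lambda>z'. a (fst z') * b (snd z') * straight W z z')
      = (\<lambda>z'. (a (fst z') * W (fst z) (fst z')) * (b (snd z') * W (snd z) (snd z')))" for z
    by (auto simp: straight_def)
  then have "clique_sum (Y \<times> Y) (straight W) (Suc q) (\<lambda>z. a (fst z) * b (snd z))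
      = (\<Sum>(x, y)\<in>Y \<times> Y. (a x * clique_sum Y W q (\<lambda>x'. a x' * W x x')) * (b y * clique_sum Y W q (\<lambda>y'. b y' * W y y')))"
    using Suc[of "\<lambda>x'. a x' * W _ x'" "\<lambda>y'. b y' * W _ y'"] by (simp add: split_beta mult_ac)
  then show ?case by (simp add: sum_product sum.cartesian_product)
qed simp

section \<open>Clique inequalities over a positive Lorentzian matrix\<close>

context
  fixes n :: nat and W :: "nat \<Rightarrow> nat \<Rightarrow> real"
  assumes sym: "\<And>i j. i < n \<Longrightarrow> j < n \<Longrightarrow> W i j = W j i"
    and W: "\<And>i j. i < n \<Longrightarrow> j < n \<Longrightarrow> 0 < W i j"
    and lor: "lorentzian n W"
begin

text \<open>Two vertices are revealed in the opposite order; only the edge joining them is read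
  backwards, and \<open>W\<close> is symmetric.\<close>

lemma clique_form_swap:
  shows "clique_form n W (c # d # cs) = clique_form n W (d # c # cs)"
proof -
  have "clique_form n W (c # d # cs)
      = (\<Sum>z<n. \<Sum>y<n. c z * (d y * W z y * clique_form n W (map (\<lambda>e v. e v * W z v * W y v) cs)))"
    by (simp add: sum_distrib_left o_def)
  also have "\<dots> = (\<Sum>y<n. \<Sum>z<n. c z * (d y * W z y * clique_form n W (map (\<lambda>e v. e v * W z v * W y v) cs)))"
    by (rule sum.swap)
  also have "\<dots> = (\<Sum>y<n. \<Sum>z<n. d y * (c z * W y z * clique_form n W (map (\<lambda>e v. e v * W y v * W z v) cs)))"
  proof (intro sum.cong refl)
    fix y z assume "y \<in> {..<n}" "z \<in> {..<n}"
    then have "W z y = W y z" using sym by auto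
    moreover have "(\<lambda>e v. e v * W z v * W y v) = (\<lambda>e v. e v * W y v * W z v)"
      by (auto simp: mult_ac)
    ultimately show "c z * (d y * W z y * clique_form n W (map (\<lambda>e v. e v * W z v * W y v) cs))
        = d y * (c z * W y z * clique_form n W (map (\<lambda>e v. e v * W y v * W z v) cs))"
      by simp
  qed
  also have "\<dots> = clique_form n W (d # c # cs)"
    by (simp add: sum_distrib_left o_def)
  finally show ?thesis .
qed

lemma clique_form_move:
  shows "clique_form n W (xs @ c # ys) = clique_form n W (c # xs @ ys)"
proof (induction "length xs" arbitrary: xs c ys)
  case (Suc m)
  then obtain d xs' where xs: "xs = d # xs'" "length xs' = m" by (cases xs) auto
  have "clique_form n W (xs @ c # ys) = clique_form n W (d # c # xs' @ ys)"
    using Suc(1)[of "map _ xs'"] xs by simp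
  also have "\<dots> = clique_form n W (c # xs @ ys)"
    unfolding xs by (simp add: clique_form_swap del: clique_form.simps)
  finally show ?case .
qed simp

lemma clique_form_pos:
  assumes "0 < n" and "\<And>c i. c \<in> set cs \<Longrightarrow> i < n \<Longrightarrow> 0 < c i"
  shows "0 < clique_form n W cs"
  using assms(2)
proof (induction "length cs" arbitrary: cs)
  case (Suc m)
  then obtain c cs' where cs: "cs = c # cs'" "length cs' = m" by (cases cs) auto
  have "0 < clique_form n W (map (\<lambda>d y. d y * W z y) cs')" if "z < n" for z
    using Suc(3) W that cs by (intro Suc(1)) auto
  then show ?case unfolding cs using Suc(3) cs \<open>0 < n\<close>
    by (auto intro!: sum_pos)
qed simp

text \<open>Alexandrov--Fenchel inequality for the clique form. Conditioning on the vertex that carries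
  \<open>c\<close> gives forms for shorter lists, and the induction hypothesis for them
  is the Bochner-type inequality.\<close>

lemma clique_form_alexandrov_fenchel:
  assumes "\<And>c i. c \<in> set cs \<Longrightarrow> i < n \<Longrightarrow> 0 < c i"
    and "\<And>i. i < n \<Longrightarrow> 0 < y i"
  shows "clique_form n W (x # x # cs) * clique_form n W (y # y # cs) \<le> (clique_form n W (x # y # cs))\<^sup>2"
  using assms
proof (induction "length cs" arbitrary: cs x y)
  case 0
  have "clique_form n W [x, y] = bform n W x y" for x y
    by (simp add: bform_def sum_distrib_left mult_ac)
  then show ?case using lor 0 by (simp add: lorentzian_def)
next
  case (Suc m)
  then obtain c cs' where cs: "cs = c # cs'" "length cs' = m" by (cases cs) auto
  have c: "0 < c i" if "i < n" for i using Suc.prems cs that by auto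
  \<comment> \<open>Fixing the images \<open>z\<close> and \<open>v\<close> of the first two
    vertices leaves a form in \<open>cs\<close>. This is the matrix whose bilinear form is
    \<open>clique_form n W (x # y # cs)\<close>.\<close>
  define A where "A z v = W z v * clique_form n W (map (\<lambda>d u. d u * W z u * W v u) cs)" for z v
  have mv: "mvec n A x z = clique_form n W (map (\<lambda>d u. d u * W z u) (x # cs))" for x z
    by (simp add: mvec_def A_def o_def mult_ac)
  have bf: "bform n A x y = clique_form n W (x # y # cs)" for x y
    unfolding bform_mvec mv by simp
  have symA: "A i j = A j i" if "i < n" "j < n" for i j
  proof -
    have "(\<lambda>d u. d u * W i u * W j u) = (\<lambda>d u. d u * W j u * W i u)" by (auto simp: mult_ac)
    then show ?thesis using sym[OF that] by (simp add: A_def)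
  qed
  have posA: "0 < A i j" if "i < n" "j < n" for i j
    unfolding A_def using that W Suc.prems
    by (intro mult_pos_pos clique_form_pos) auto
  have "lorentzian n A"
  proof (rule lorentzian_of_bochner[where w = c])
    fix x
    have "bform n A x x = clique_form n W (c # x # x # cs')"
      unfolding bf cs using clique_form_move[of "[x, x]" c cs'] by simp
    also have "\<dots> = (\<Sum>z<n. c z * clique_form n W (map (\<lambda>d u. d u * W z u) (x # x # cs')))"
      by simp
    also have "\<dots> \<le> (\<Sum>z<n. c z * (mvec n A x z)\<^sup>2 / mvec n A c z)"
    proof (intro sum_mono)
      fix z assume "z \<in> {..<n}"
      then have z: "z < n" by simp
      let ?m = "\<lambda>d u. d u * W z u"
      \<comment> \<open>The induction hypothesis with the image \<open>z\<close> of the vertex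
        carrying \<open>c\<close> fixed, and with \<open>c\<close> in the role of the positive
        vector. The second factor is \<open>mvec n A c z\<close> and the squared term comes from
        \<open>mvec n A x z\<close>, because \<open>cs\<close> starts with \<open>c\<close>.\<close>
      have "clique_form n W (?m x # ?m x # map ?m cs') * clique_form n W (?m c # ?m c # map ?m cs')
          \<le> (clique_form n W (?m x # ?m c # map ?m cs'))\<^sup>2"
        using Suc.prems cs W z by (intro Suc.hyps(1)) auto
      then have "clique_form n W (map ?m (x # x # cs')) * mvec n A c z \<le> (mvec n A x z)\<^sup>2"
        unfolding mv cs by simp
      moreover have "0 < mvec n A c z"
        unfolding mvec_def using c posA z by (intro sum_pos) auto
      ultimately have "clique_form n W (map ?m (x # x # cs')) \<le> (mvec n A x z)\<^sup>2 / mvec n A c z"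
        by (simp only: pos_le_divide_eq)
      then show "c z * clique_form n W (map ?m (x # x # cs')) \<le> c z * (mvec n A x z)\<^sup>2 / mvec n A c z"
        using mult_left_mono[OF _ less_imp_le[OF c[OF z]]] by (simp only: times_divide_eq_right[symmetric])
    qed
    finally show "bform n A x x \<le> (\<Sum>i<n. c i * (mvec n A x i)\<^sup>2 / mvec n A c i)" .
  qed (use symA posA c in auto)
  then show ?case using Suc.prems(2) by (auto simp: lorentzian_def bf)
qed

text \<open>Replacing the weights \<open>b\<close> by \<open>a\<close> one vertex at a time gives a
  sequence that is log-concave by Alexandrov--Fenchel; the claim compares its two ends with their
  neighbours.\<close>

lemma clique_form_exchange:
  assumes "0 < n"
    and a: "\<And>i. i < n \<Longrightarrow> 0 < a i" and b: "\<And>i. i < n \<Longrightarrow> 0 < b i"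
  shows "clique_form n W (replicate (Suc q) a) * clique_form n W (replicate (Suc q) b)
    \<le> clique_form n W (b # replicate q a) * clique_form n W (a # replicate q b)"
proof -
  define f where "f k = clique_form n W (replicate k a @ replicate (Suc q - k) b)" for k
  have "f 0 * f (Suc q) \<le> f 1 * f q"
  proof (rule log_concave_ends[where m = "Suc q"])
    show "0 < f k" for k
      unfolding f_def using a b \<open>0 < n\<close> W by (intro clique_form_pos) auto
    fix k assume k: "Suc (Suc k) \<le> Suc q"
    define r where "r = q - Suc k"
    have r: "Suc q - k = Suc (Suc r)" "Suc q - Suc k = Suc r" "Suc q - Suc (Suc k) = r"
      using k by (auto simp: r_def)
    let ?cs = "replicate k a @ replicate r b"
    note mv = clique_form_move
    have "f k = clique_form n W (b # b # ?cs)"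
      unfolding f_def r
      using mv[of "replicate k a" b "b # replicate r b"] mv[of "b # replicate k a" b "replicate r b"]
      by (simp del: clique_form.simps)
    moreover have "f (Suc k) = clique_form n W (a # b # ?cs)"
      unfolding f_def r
      using mv[of "a # replicate k a" b "replicate r b"] clique_form_swap[of a b]
      by (simp del: clique_form.simps)
    moreover have "f (Suc (Suc k)) = clique_form n W (a # a # ?cs)"
      unfolding f_def r by simp
    moreover have "clique_form n W (a # a # ?cs) * clique_form n W (b # b # ?cs) \<le> (clique_form n W (a # b # ?cs))\<^sup>2"
      using a b by (intro clique_form_alexandrov_fenchel) auto
    ultimately show "f k * f (Suc (Suc k)) \<le> (f (Suc k))\<^sup>2" by (simp add: mult.commute)
  qed simp
  moreover have "f q = clique_form n W (b # replicate q a)"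
    unfolding f_def using clique_form_move[of "replicate q a" b "[]"]
    by (simp del: clique_form.simps add: Suc_diff_le)
  ultimately show ?thesis by (simp add: f_def mult.commute del: clique_form.simps)
qed

text \<open>One matched pair of vertices of \<open>K\<^sub>q \<times> K\<^sub>2\<close> is revealed at a time;
  the exchange inequality then swaps the two weights of that pair.\<close>

lemma clique_sum_straight_le_crossed:
  assumes "\<And>i. i < n \<Longrightarrow> 0 < a i" and "\<And>i. i < n \<Longrightarrow> 0 < b i"
  shows "clique_sum ({..<n} \<times> {..<n}) (straight W) q (\<lambda>z. a (fst z) * b (snd z))
    \<le> clique_sum ({..<n} \<times> {..<n}) (crossed W) q (\<lambda>z. a (fst z) * b (snd z))"
  using assms
proof (induction q arbitrary: a b)
  case (Suc q)
  let ?Y = "{..<n}"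
  show ?case
  proof (cases "n = 0")
    case False
    have crossed_eq: "(\<lambda>z'. a (fst z') * b (snd z') * crossed W z z')
        = (\<lambda>z'. (a (fst z') * W (snd z) (fst z')) * (b (snd z') * W (fst z) (snd z')))" for z
      by (auto simp: crossed_def)
    have "clique_sum (?Y \<times> ?Y) (straight W) (Suc q) (\<lambda>z. a (fst z) * b (snd z))
        = clique_form n W (replicate (Suc q) a) * clique_form n W (replicate (Suc q) b)"
      unfolding clique_form_replicate clique_sum_straight by (rule refl)
    also have "\<dots> \<le> clique_form n W (b # replicate q a) * clique_form n W (a # replicate q b)"
      using False Suc.prems by (intro clique_form_exchange) auto
    \<comment> \<open>After the exchange the vertex of weight \<open>b\<close>, placed at
      \<open>y\<close>, is joined to the vertices of weight \<open>a\<close>, and the vertex of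
      weight \<open>a\<close>, placed at \<open>x\<close>, to those of weight \<open>b\<close>.
      These are the crossed edges at the revealed pair.\<close>
    also have "\<dots> = (\<Sum>y<n. b y * clique_sum ?Y W q (\<lambda>v. a v * W y v))
        * (\<Sum>x<n. a x * clique_sum ?Y W q (\<lambda>v. b v * W x v))"
      by (simp add: clique_form_replicate)
    also have "\<dots> = (\<Sum>x<n. \<Sum>y<n. a x * b y * (clique_sum ?Y W q (\<lambda>v. a v * W y v) * clique_sum ?Y W q (\<lambda>v. b v * W x v)))"
      unfolding sum_product by (subst sum.swap) (simp add: mult_ac)
    also have "\<dots> = (\<Sum>z\<in>?Y \<times> ?Y. a (fst z) * b (snd z) *
        clique_sum (?Y \<times> ?Y) (straight W) q (\<lambda>z'. (a (fst z') * W (snd z) (fst z')) * (b (snd z') * W (fst z) (snd z'))))"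
      by (simp add: sum.cartesian_product split_beta
          clique_sum_straight[of _ W q "\<lambda>v. a v * W _ v" "\<lambda>v. b v * W _ v"])
    also have "\<dots> \<le> (\<Sum>z\<in>?Y \<times> ?Y. a (fst z) * b (snd z) *
        clique_sum (?Y \<times> ?Y) (crossed W) q (\<lambda>z'. (a (fst z') * W (snd z) (fst z')) * (b (snd z') * W (fst z) (snd z'))))"
    proof (intro sum_mono mult_left_mono)
      fix z assume "z \<in> ?Y \<times> ?Y"
      then have z: "fst z < n" "snd z < n" by auto
      show "clique_sum (?Y \<times> ?Y) (straight W) q (\<lambda>z'. (a (fst z') * W (snd z) (fst z')) * (b (snd z') * W (fst z) (snd z')))
          \<le> clique_sum (?Y \<times> ?Y) (crossed W) q (\<lambda>z'. (a (fst z') * W (snd z) (fst z')) * (b (snd z') * W (fst z) (snd z')))"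
        using Suc.prems z W by (intro Suc.IH) auto
      show "0 \<le> a (fst z) * b (snd z)" using Suc.prems z by (simp add: less_imp_le)
    qed
    also have "\<dots> = clique_sum (?Y \<times> ?Y) (crossed W) (Suc q) (\<lambda>z. a (fst z) * b (snd z))"
      by (simp add: crossed_eq)
    finally show ?thesis .
  qed simp
qed simp

end

section \<open>Sums over maps of graphs\<close>

text \<open>The same choice of endpoints as in \<open>edge_weight\<close>, for a general function of
  two vertices; this accommodates kernels that depend on the vertices and not only on their
  images.\<close>

definition pair_weight :: "('a \<Rightarrow> 'a \<Rightarrow> real) \<Rightarrow> 'a set \<Rightarrow> real" where
  "pair_weight g e = (let (u, v) = (SOME (u, v). e = {u, v}) in g u v)"

lemma edge_weight_eq_pair_weight: "edge_weight W \<phi> = pair_weight (\<lambda>u v. W (\<phi> u) (\<phi> v))"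
  by (rule ext) (simp add: edge_weight_def pair_weight_def)

text \<open>The chosen orientation depends on \<open>e\<close> alone, so one pair of endpoints
  serves every \<open>g\<close> at once.\<close>

lemma pair_weight_obtain:
  assumes "e \<in> edges V adj"
  obtains u v where "u \<in> V" "v \<in> V" "e = {u, v}" "adj u v \<or> adj v u" "\<And>g. pair_weight g e = g u v"
proof -
  obtain a b where ab: "e = {a, b}" "a \<in> V" "b \<in> V" "adj a b" using assms by (auto simp: edges_def)
  define q where "q = (SOME (u, v). e = {u, v})"
  have "case q of (u, v) \<Rightarrow> e = {u, v}"
    unfolding q_def by (rule someI[of _ "(a, b)"]) (simp add: ab)
  then obtain u v where q: "q = (u, v)" and e: "e = {u, v}" by (cases q) auto
  have uv: "(u = a \<and> v = b) \<or> (u = b \<and> v = a)" using e ab(1) by (auto simp: doubleton_eq_iff)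
  have pw: "pair_weight g e = g u v" for g
    unfolding pair_weight_def q_def[symmetric] q by simp
  show thesis by (rule that[OF _ _ e _ pw]) (use uv ab in auto)
qed

lemma pair_weight_doubleton:
  assumes "g u v = g v u"
  shows "pair_weight g {u, v} = g u v"
proof -
  define q where "q = (SOME (a, b). {u, v} = {a, b})"
  have "case q of (a, b) \<Rightarrow> {u, v} = {a, b}"
    unfolding q_def by (rule someI[of _ "(u, v)"]) simp
  then obtain a b where q: "q = (a, b)" and e: "{u, v} = {a, b}" by (cases q) auto
  have "pair_weight g {u, v} = g a b"
    unfolding pair_weight_def q_def[symmetric] q by simp
  moreover have "(u = a \<and> v = b) \<or> (u = b \<and> v = a)" using e by (simp add: doubleton_eq_iff)
  ultimately show ?thesis using assms by metis
qed

lemma pair_weight_cong: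
  assumes "e \<in> edges V adj"
    and "\<And>u v. u \<in> V \<Longrightarrow> v \<in> V \<Longrightarrow> adj u v \<or> adj v u \<Longrightarrow> g u v = h u v"
  shows "pair_weight g e = pair_weight h e"
  by (rule pair_weight_obtain[OF assms(1)]) (use assms(2) in auto)

lemma pair_weight_mult: "pair_weight g e * pair_weight h e = pair_weight (\<lambda>u v. g u v * h u v) e"
  by (simp add: pair_weight_def split_beta Let_def)

lemma finite_edges: "finite V \<Longrightarrow> finite (edges V adj)"
  by (rule finite_subset[of _ "Pow V"]) (auto simp: edges_def)

text \<open>Edges between the parts are indexed by their ordered pairs from \<open>C\<close> to
  \<open>R\<close>. Disjointness makes this indexing injective, and symmetry of \<open>g\<close>
  across the parts makes the chosen orientation harmless.\<close>

lemma prod_edges_Un: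
  assumes fin: "finite C" "finite R" and disj: "C \<inter> R = {}"
    and sym: "\<And>u v. adj u v \<Longrightarrow> adj v u"
    and g: "\<And>u v. u \<in> C \<Longrightarrow> v \<in> R \<Longrightarrow> g u v = g v u"
  shows "(\<Prod>e\<in>edges (C \<union> R) adj. pair_weight g e)
    = (\<Prod>e\<in>edges C adj. pair_weight g e) * (\<Prod>e\<in>edges R adj. pair_weight g e)
      * (\<Prod>u\<in>C. \<Prod>v\<in>{v\<in>R. adj u v}. g u v)"
proof -
  define X where "X = (SIGMA u:C. {v\<in>R. adj u v})"
  define B where "B = (\<lambda>(u, v). {u, v}) ` X"
  have finX: "finite X" unfolding X_def using fin by auto
  have split: "edges (C \<union> R) adj = edges C adj \<union> edges R adj \<union> B"
  proof (intro equalityI subsetI)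
    fix e assume "e \<in> edges (C \<union> R) adj"
    then obtain u v where e: "e = {u, v}" "u \<in> C \<union> R" "v \<in> C \<union> R" "adj u v"
      by (auto simp: edges_def)
    have "adj v u" by (rule sym[OF e(4)])
    consider "u \<in> C" "v \<in> C" | "u \<in> R" "v \<in> R" | "u \<in> C" "v \<in> R" | "u \<in> R" "v \<in> C"
      using e by blast
    then show "e \<in> edges C adj \<union> edges R adj \<union> B"
    proof cases
      case 3
      then have "(u, v) \<in> X" using e by (auto simp: X_def)
      then show ?thesis unfolding B_def e by force
    next
      case 4
      then have "(v, u) \<in> X" using \<open>adj v u\<close> by (auto simp: X_def)
      then show ?thesis unfolding B_def e by force
    qed (use e in \<open>auto simp: edges_def\<close>)
  next
    fix e assume "e \<in> edges C adj \<union> edges R adj \<union> B"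
    then show "e \<in> edges (C \<union> R) adj" by (auto simp: edges_def B_def X_def)
  qed
  have d1: "edges C adj \<inter> edges R adj = {}" using disj by (auto simp: edges_def doubleton_eq_iff)
  have d2: "(edges C adj \<union> edges R adj) \<inter> B = {}"
    using disj by (auto simp: edges_def B_def X_def doubleton_eq_iff)
  have inj: "inj_on (\<lambda>(u, v). {u, v}) X"
    using disj by (auto simp: inj_on_def X_def doubleton_eq_iff)
  have "(\<Prod>e\<in>B. pair_weight g e) = (\<Prod>x\<in>X. pair_weight g (case x of (u, v) \<Rightarrow> {u, v}))"
    unfolding B_def by (subst prod.reindex[OF inj]) simp
  also have "\<dots> = (\<Prod>(u, v)\<in>X. g u v)"
    using g by (intro prod.cong refl) (auto simp: X_def intro!: pair_weight_doubleton)
  also have "\<dots> = (\<Prod>u\<in>C. \<Prod>v\<in>{v\<in>R. adj u v}. g u v)"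
    unfolding X_def using fin by (subst prod.Sigma) auto
  finally have B: "(\<Prod>e\<in>B. pair_weight g e) = (\<Prod>u\<in>C. \<Prod>v\<in>{v\<in>R. adj u v}. g u v)" .
  have "finite B" unfolding B_def using finX by simp
  then show ?thesis
    unfolding split B[symmetric]
    using fin d1 d2 by (simp add: prod.union_disjoint finite_edges)
qed

lemma edges_empty [simp]: "edges {} adj = {}"
  by (auto simp: edges_def)

lemma edges_singleton: "\<not> adj c c \<Longrightarrow> edges {c} adj = {}"
  by (auto simp: edges_def)

lemma prod_edges_insert:
  assumes "finite V" "c \<notin> V" "\<not> adj c c"
    and "\<And>u v. adj u v \<Longrightarrow> adj v u"
    and "\<And>v. v \<in> V \<Longrightarrow> g c v = g v c"
  shows "(\<Prod>e\<in>edges (insert c V) adj. pair_weight g e)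
    = (\<Prod>e\<in>edges V adj. pair_weight g e) * (\<Prod>v\<in>{v\<in>V. adj c v}. g c v)"
  using prod_edges_Un[of "{c}" V adj g] assms by (simp add: edges_singleton)

text \<open>Each edge is met once from either end. This matches the two edges of the tensor product
  that lie above one edge of the graph.\<close>

lemma prod_adjacent_pairs:
  assumes "finite V" and sym: "\<And>u v. adj u v \<Longrightarrow> adj v u" and irr: "\<And>u. \<not> adj u u"
  shows "(\<Prod>u\<in>V. \<Prod>v\<in>{v\<in>V. adj u v}. h u v) = (\<Prod>e\<in>edges V adj. pair_weight (\<lambda>u v. h u v * h v u) e)"
  using \<open>finite V\<close>
proof (induction V rule: finite_induct)
  case (insert c V)
  have inner: "(\<Prod>v\<in>{v\<in>insert c V. adj u v}. h u v)
      = (if adj u c then h u c else 1) * (\<Prod>v\<in>{v\<in>V. adj u v}. h u v)" for u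
  proof (cases "adj u c")
    case True
    then have "{v\<in>insert c V. adj u v} = insert c {v\<in>V. adj u v}" by auto
    then show ?thesis using True insert by simp
  next
    case False
    then have "{v\<in>insert c V. adj u v} = {v\<in>V. adj u v}" by auto
    then show ?thesis using False by simp
  qed
  have "(\<Prod>u\<in>V. if adj u c then h u c else 1) = (\<Prod>u\<in>{u\<in>V. adj u c}. h u c)"
    using insert by (simp add: prod.inter_filter)
  also have "{u\<in>V. adj u c} = {u\<in>V. adj c u}" using sym by blast
  finally have col: "(\<Prod>u\<in>V. if adj u c then h u c else 1) = (\<Prod>u\<in>{u\<in>V. adj c u}. h u c)" .
  have "(\<Prod>u\<in>insert c V. \<Prod>v\<in>{v\<in>insert c V. adj u v}. h u v)
      = (\<Prod>v\<in>{v\<in>V. adj c v}. h c v) * ((\<Prod>u\<in>{u\<in>V. adj c u}. h u c) * (\<Prod>u\<in>V. \<Prod>v\<in>{v\<in>V. adj u v}. h u v))"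
    unfolding inner using insert irr by (simp add: prod.distrib col)
  also have "\<dots> = (\<Prod>e\<in>edges V adj. pair_weight (\<lambda>u v. h u v * h v u) e) * (\<Prod>v\<in>{v\<in>V. adj c v}. h c v * h v c)"
    unfolding insert.IH by (simp add: prod.distrib)
  also have "\<dots> = (\<Prod>e\<in>edges (insert c V) adj. pair_weight (\<lambda>u v. h u v * h v u) e)"
    using insert sym irr by (intro prod_edges_insert[symmetric]) auto
  finally show ?case .
qed simp

section \<open>Decomposing sums over maps\<close>

lemma sum_PiE_Un:
  assumes "C \<inter> R = {}"
  shows "(\<Sum>\<chi>\<in>(C \<union> R) \<rightarrow>\<^sub>E Y. F \<chi>)
    = (\<Sum>\<rho>\<in>R \<rightarrow>\<^sub>E Y. \<Sum>\<kappa>\<in>C \<rightarrow>\<^sub>E Y. F (\<lambda>u. if u \<in> C then \<kappa> u else \<rho> u))"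
  unfolding sum.cartesian_product
proof (rule sum.reindex_bij_witness[where
        j = "\<lambda>\<chi>. (restrict \<chi> R, restrict \<chi> C)" and
        i = "\<lambda>(\<rho>, \<kappa>). \<lambda>u. if u \<in> C then \<kappa> u else \<rho> u"])
  fix \<chi> assume \<chi>: "\<chi> \<in> C \<union> R \<rightarrow>\<^sub>E Y"
  have eq: "(\<lambda>u. if u \<in> C then restrict \<chi> C u else restrict \<chi> R u) = \<chi>"
    using \<chi> by (auto simp: PiE_iff extensional_def fun_eq_iff)
  then show "(case (restrict \<chi> R, restrict \<chi> C) of (\<rho>, \<kappa>) \<Rightarrow> \<lambda>u. if u \<in> C then \<kappa> u else \<rho> u) = \<chi>"
    by simp
  show "(case (restrict \<chi> R, restrict \<chi> C) of (\<rho>, \<kappa>) \<Rightarrow> F (\<lambda>u. if u \<in> C then \<kappa> u else \<rho> u)) = F \<chi>"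
    unfolding prod.case eq ..
  show "(restrict \<chi> R, restrict \<chi> C) \<in> (R \<rightarrow>\<^sub>E Y) \<times> (C \<rightarrow>\<^sub>E Y)"
    using \<chi> by (auto simp: PiE_iff)
next
  fix x assume "x \<in> (R \<rightarrow>\<^sub>E Y) \<times> (C \<rightarrow>\<^sub>E Y)"
  then obtain \<rho> \<kappa> where x: "x = (\<rho>, \<kappa>)" "\<rho> \<in> R \<rightarrow>\<^sub>E Y" "\<kappa> \<in> C \<rightarrow>\<^sub>E Y" by auto
  let ?\<chi> = "\<lambda>u. if u \<in> C then \<kappa> u else \<rho> u"
  have "restrict ?\<chi> R = \<rho>" "restrict ?\<chi> C = \<kappa>"
    using x assms by (auto simp: PiE_iff extensional_def fun_eq_iff)
  then show "(restrict (case x of (\<rho>, \<kappa>) \<Rightarrow> \<lambda>u. if u \<in> C then \<kappa> u else \<rho> u) R,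
      restrict (case x of (\<rho>, \<kappa>) \<Rightarrow> \<lambda>u. if u \<in> C then \<kappa> u else \<rho> u) C) = x"
    by (simp add: x)
  show "(case x of (\<rho>, \<kappa>) \<Rightarrow> \<lambda>u. if u \<in> C then \<kappa> u else \<rho> u) \<in> C \<union> R \<rightarrow>\<^sub>E Y"
    using x by (auto simp: PiE_iff extensional_def)
qed

lemma sum_PiE_insert:
  assumes "c \<notin> C"
  shows "(\<Sum>\<chi>\<in>insert c C \<rightarrow>\<^sub>E Y. F \<chi>) = (\<Sum>z\<in>Y. \<Sum>\<chi>\<in>C \<rightarrow>\<^sub>E Y. F (\<chi>(c := z)))"
  unfolding sum.cartesian_product
  by (rule sum.reindex_bij_witness[where
        j = "\<lambda>\<chi>. (\<chi> c, \<chi>(c := undefined))" and i = "\<lambda>(z, \<chi>). \<chi>(c := z)"])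
    (use assms in \<open>auto simp: PiE_iff extensional_def fun_eq_iff\<close>)

text \<open>Links the recursion to actual sums over maps: a removed vertex \<open>c\<close> is
  adjacent to all others, so its edges multiply every remaining weight by
  \<open>k z\<close>.\<close>

lemma sum_complete_graph:
  fixes k :: "'z \<Rightarrow> 'z \<Rightarrow> real"
  assumes "finite C" and complete: "\<And>u v. u \<in> C \<Longrightarrow> v \<in> C \<Longrightarrow> adj u v \<longleftrightarrow> u \<noteq> v"
    and sym: "\<And>u v. adj u v \<Longrightarrow> adj v u"
    and k: "\<And>z z'. z \<in> Y \<Longrightarrow> z' \<in> Y \<Longrightarrow> k z z' = k z' z"
  shows "(\<Sum>\<chi>\<in>C \<rightarrow>\<^sub>E Y. (\<Prod>u\<in>C. \<gamma> (\<chi> u)) * (\<Prod>e\<in>edges C adj. pair_weight (\<lambda>u v. k (\<chi> u) (\<chi> v)) e))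
    = clique_sum Y k (card C) \<gamma>"
  using assms(1,2)
proof (induction C arbitrary: \<gamma> rule: finite_induct)
  case (insert c C)
  have step: "(\<Prod>u\<in>insert c C. \<gamma> ((\<chi>(c := z)) u))
        * (\<Prod>e\<in>edges (insert c C) adj. pair_weight (\<lambda>u v. k ((\<chi>(c := z)) u) ((\<chi>(c := z)) v)) e)
      = \<gamma> z * ((\<Prod>u\<in>C. \<gamma> (\<chi> u) * k z (\<chi> u)) * (\<Prod>e\<in>edges C adj. pair_weight (\<lambda>u v. k (\<chi> u) (\<chi> v)) e))"
    if \<chi>: "\<chi> \<in> C \<rightarrow>\<^sub>E Y" and z: "z \<in> Y" for \<chi> z
  proof -
    let ?g = "\<lambda>u v. k ((\<chi>(c := z)) u) ((\<chi>(c := z)) v)"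
    have "(\<Prod>e\<in>edges (insert c C) adj. pair_weight ?g e)
        = (\<Prod>e\<in>edges C adj. pair_weight ?g e) * (\<Prod>v\<in>{v\<in>C. adj c v}. ?g c v)"
      using insert.hyps insert.prems sym k \<chi> z by (intro prod_edges_insert) (auto simp: PiE_iff)
    also have "(\<Prod>e\<in>edges C adj. pair_weight ?g e) = (\<Prod>e\<in>edges C adj. pair_weight (\<lambda>u v. k (\<chi> u) (\<chi> v)) e)"
      using insert.hyps by (intro prod.cong refl pair_weight_cong) auto
    also have "{v\<in>C. adj c v} = C" using insert by auto
    also have "(\<Prod>v\<in>C. ?g c v) = (\<Prod>v\<in>C. k z (\<chi> v))"
      using insert.hyps by (intro prod.cong refl) auto
    finally have E: "(\<Prod>e\<in>edges (insert c C) adj. pair_weight ?g e)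
        = (\<Prod>e\<in>edges C adj. pair_weight (\<lambda>u v. k (\<chi> u) (\<chi> v)) e) * (\<Prod>v\<in>C. k z (\<chi> v))" .
    have "(\<Prod>u\<in>insert c C. \<gamma> ((\<chi>(c := z)) u)) = \<gamma> z * (\<Prod>u\<in>C. \<gamma> (\<chi> u))"
      using insert.hyps by (subst prod.insert) (auto intro!: arg_cong2[where f = "(*)"] prod.cong)
    then show ?thesis unfolding E by (simp add: prod.distrib)
  qed
  have "(\<Sum>\<chi>\<in>insert c C \<rightarrow>\<^sub>E Y. (\<Prod>u\<in>insert c C. \<gamma> (\<chi> u))
        * (\<Prod>e\<in>edges (insert c C) adj. pair_weight (\<lambda>u v. k (\<chi> u) (\<chi> v)) e))
      = (\<Sum>z\<in>Y. \<Sum>\<chi>\<in>C \<rightarrow>\<^sub>E Y. \<gamma> z * ((\<Prod>u\<in>C. \<gamma> (\<chi> u) * k z (\<chi> u))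
          * (\<Prod>e\<in>edges C adj. pair_weight (\<lambda>u v. k (\<chi> u) (\<chi> v)) e)))"
    unfolding sum_PiE_insert[OF insert.hyps(2)] by (intro sum.cong refl step)
  also have "\<dots> = (\<Sum>z\<in>Y. \<gamma> z * clique_sum Y k (card C) (\<lambda>z'. \<gamma> z' * k z z'))"
    unfolding sum_distrib_left[symmetric] using insert.prems
    by (intro sum.cong refl arg_cong2[where f = "(*)"] insert.IH) auto
  finally show ?case using insert.hyps by simp
qed simp

lemma straight_commute:
  assumes "\<And>i j. i < n \<Longrightarrow> j < n \<Longrightarrow> W i j = W j i"
    and "z \<in> {..<n} \<times> {..<n}" "z' \<in> {..<n} \<times> {..<n}"
  shows "straight W z z' = straight W z' z"
  using assms by (auto simp: straight_def)

lemma crossed_commute: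
  assumes "\<And>i j. i < n \<Longrightarrow> j < n \<Longrightarrow> W i j = W j i"
    and "z \<in> {..<n} \<times> {..<n}" "z' \<in> {..<n} \<times> {..<n}"
  shows "crossed W z z' = crossed W z' z"
  using assms by (auto simp: crossed_def)

section \<open>Both sides of the inequality as sums over maps into pairs\<close>

lemma hom_square:
  "(hom V adj n W)\<^sup>2
    = (\<Sum>\<chi>\<in>V \<rightarrow>\<^sub>E {..<n} \<times> {..<n}. \<Prod>e\<in>edges V adj. pair_weight (\<lambda>u v. straight W (\<chi> u) (\<chi> v)) e)"
proof -
  let ?X = "{..<n}"
  have "(hom V adj n W)\<^sup>2 = (\<Sum>(\<phi>, \<psi>)\<in>(V \<rightarrow>\<^sub>E ?X) \<times> (V \<rightarrow>\<^sub>E ?X).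
      \<Prod>e\<in>edges V adj. pair_weight (\<lambda>u v. W (\<phi> u) (\<phi> v) * W (\<psi> u) (\<psi> v)) e)"
    unfolding hom_def power2_eq_square sum_product sum.cartesian_product edge_weight_eq_pair_weight
      prod.distrib[symmetric] pair_weight_mult atLeast0LessThan ..
  also have "\<dots> = (\<Sum>\<chi>\<in>V \<rightarrow>\<^sub>E ?X \<times> ?X. \<Prod>e\<in>edges V adj. pair_weight (\<lambda>u v. straight W (\<chi> u) (\<chi> v)) e)"
  proof (rule sum.reindex_bij_witness[where
        j = "\<lambda>(\<phi>, \<psi>). \<lambda>u\<in>V. (\<phi> u, \<psi> u)" and i = "\<lambda>\<chi>. (\<lambda>u\<in>V. fst (\<chi> u), \<lambda>u\<in>V. snd (\<chi> u))"])
    fix \<chi> assume "\<chi> \<in> V \<rightarrow>\<^sub>E ?X \<times> ?X"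
    then show "(case (\<lambda>u\<in>V. fst (\<chi> u), \<lambda>u\<in>V. snd (\<chi> u)) of (\<phi>, \<psi>) \<Rightarrow> \<lambda>u\<in>V. (\<phi> u, \<psi> u)) = \<chi>"
      and "(\<lambda>u\<in>V. fst (\<chi> u), \<lambda>u\<in>V. snd (\<chi> u)) \<in> (V \<rightarrow>\<^sub>E ?X) \<times> (V \<rightarrow>\<^sub>E ?X)"
      by (auto simp: PiE_iff extensional_def fun_eq_iff mem_Times_iff)
  next
    fix p assume "p \<in> (V \<rightarrow>\<^sub>E ?X) \<times> (V \<rightarrow>\<^sub>E ?X)"
    then obtain \<phi> \<psi> where p: "p = (\<phi>, \<psi>)" "\<phi> \<in> V \<rightarrow>\<^sub>E ?X" "\<psi> \<in> V \<rightarrow>\<^sub>E ?X" by auto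
    then show "(\<lambda>u\<in>V. fst ((case p of (\<phi>, \<psi>) \<Rightarrow> \<lambda>u\<in>V. (\<phi> u, \<psi> u)) u),
          \<lambda>u\<in>V. snd ((case p of (\<phi>, \<psi>) \<Rightarrow> \<lambda>u\<in>V. (\<phi> u, \<psi> u)) u)) = p"
      and "(case p of (\<phi>, \<psi>) \<Rightarrow> \<lambda>u\<in>V. (\<phi> u, \<psi> u)) \<in> V \<rightarrow>\<^sub>E ?X \<times> ?X"
      by (auto simp: PiE_iff extensional_def fun_eq_iff)
    show "(\<Prod>e\<in>edges V adj. pair_weight (\<lambda>u v. straight W ((case p of (\<phi>, \<psi>) \<Rightarrow> \<lambda>u\<in>V. (\<phi> u, \<psi> u)) u)
            ((case p of (\<phi>, \<psi>) \<Rightarrow> \<lambda>u\<in>V. (\<phi> u, \<psi> u)) v)) e)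
        = (case p of (\<phi>, \<psi>) \<Rightarrow> \<Prod>e\<in>edges V adj. pair_weight (\<lambda>u v. W (\<phi> u) (\<phi> v) * W (\<psi> u) (\<psi> v)) e)"
      unfolding p by (auto intro!: prod.cong pair_weight_cong simp: straight_def)
  qed
  finally show ?thesis .
qed

text \<open>The images of the two copies of a vertex form one pair. All edges run between the two
  layers, and the two edges above an edge of the graph multiply to the \<open>crossed\<close>
  kernel.\<close>

lemma hom_tensor_K2:
  assumes W: "\<And>i j. i < n \<Longrightarrow> j < n \<Longrightarrow> W i j = W j i"
    and "finite V" and sym: "\<And>u v. adj u v \<Longrightarrow> adj v u" and irr: "\<And>u. \<not> adj u u"
  shows "hom (tensor_K2_verts V) (tensor_K2_adj adj) n W
    = (\<Sum>\<chi>\<in>V \<rightarrow>\<^sub>E {..<n} \<times> {..<n}. \<Prod>e\<in>edges V adj. pair_weight (\<lambda>u v. crossed W (\<chi> u) (\<chi> v)) e)"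
proof -
  let ?X = "{..<n}" and ?T = "V \<times> (UNIV :: bool set)"
  let ?f = "\<lambda>\<Phi>. \<lambda>u\<in>V. (\<Phi> (u, False), \<Phi> (u, True))"
  let ?h = "\<lambda>\<chi>. \<lambda>(u, b)\<in>?T. if b then snd (\<chi> u) else fst (\<chi> u)"
  have "hom (tensor_K2_verts V) (tensor_K2_adj adj) n W
      = (\<Sum>\<Phi>\<in>?T \<rightarrow>\<^sub>E ?X. \<Prod>e\<in>edges ?T (tensor_K2_adj adj). pair_weight (\<lambda>x y. W (\<Phi> x) (\<Phi> y)) e)"
    unfolding hom_def tensor_K2_verts_def edge_weight_eq_pair_weight atLeast0LessThan ..
  also have "\<dots> = (\<Sum>\<chi>\<in>V \<rightarrow>\<^sub>E ?X \<times> ?X. \<Prod>e\<in>edges V adj. pair_weight (\<lambda>u v. crossed W (\<chi> u) (\<chi> v)) e)"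
  proof (rule sum.reindex_bij_witness[where j = ?f and i = ?h])
    fix \<chi> assume "\<chi> \<in> V \<rightarrow>\<^sub>E ?X \<times> ?X"
    then show "?f (?h \<chi>) = \<chi>" and "?h \<chi> \<in> ?T \<rightarrow>\<^sub>E ?X"
      by (auto simp: PiE_iff extensional_def fun_eq_iff mem_Times_iff)
  next
    fix \<Phi> assume \<Phi>: "\<Phi> \<in> ?T \<rightarrow>\<^sub>E ?X"
    show "?h (?f \<Phi>) = \<Phi>" and "?f \<Phi> \<in> V \<rightarrow>\<^sub>E ?X \<times> ?X"
      using \<Phi> by (auto simp: PiE_iff extensional_def fun_eq_iff)
    have lt: "\<Phi> (u, b) < n" if "u \<in> V" for u b using \<Phi> that by (auto simp: PiE_iff)
    let ?C = "V \<times> {False}" and ?R = "V \<times> {True}"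
    let ?g = "\<lambda>x y. W (\<Phi> x) (\<Phi> y)"
    have T: "?T = ?C \<union> ?R" by auto
    have empty: "edges ?C (tensor_K2_adj adj) = {}" "edges ?R (tensor_K2_adj adj) = {}"
      by (auto simp: edges_def tensor_K2_adj_def)
    have "(\<Prod>e\<in>edges ?T (tensor_K2_adj adj). pair_weight ?g e)
        = (\<Prod>x\<in>?C. \<Prod>y\<in>{y\<in>?R. tensor_K2_adj adj x y}. ?g x y)"
      unfolding T by (subst prod_edges_Un)
        (use \<open>finite V\<close> sym W lt in \<open>auto simp: empty tensor_K2_adj_def\<close>)
    also have "\<dots> = (\<Prod>u\<in>V. \<Prod>y\<in>{y\<in>?R. tensor_K2_adj adj (u, False) y}. ?g (u, False) y)"
      by (rule prod.reindex_bij_witness[where j = fst and i = "\<lambda>u. (u, False)"]) auto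
    also have "\<dots> = (\<Prod>u\<in>V. \<Prod>v\<in>{v\<in>V. adj u v}. ?g (u, False) (v, True))"
      by (intro prod.cong refl prod.reindex_bij_witness[where j = fst and i = "\<lambda>v. (v, True)"])
        (auto simp: tensor_K2_adj_def)
    also have "\<dots> = (\<Prod>e\<in>edges V adj. pair_weight (\<lambda>u v. ?g (u, False) (v, True) * ?g (v, False) (u, True)) e)"
      by (rule prod_adjacent_pairs[OF \<open>finite V\<close> sym irr])
    also have "\<dots> = (\<Prod>e\<in>edges V adj. pair_weight (\<lambda>u v. crossed W (?f \<Phi> u) (?f \<Phi> v)) e)"
      using W lt by (intro prod.cong refl pair_weight_cong) (auto simp: crossed_def)
    finally show "(\<Prod>e\<in>edges V adj. pair_weight (\<lambda>u v. crossed W (?f \<Phi> u) (?f \<Phi> v)) e)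
        = (\<Prod>e\<in>edges ?T (tensor_K2_adj adj). pair_weight ?g e)" by simp
  qed
  finally show ?thesis .
qed

section \<open>Crossing the cliques\<close>

text \<open>\<open>S\<close> collects the cliques already crossed, while edges between different
  cliques are crossed from the start. Enlarging \<open>S\<close> interpolates between the square of
  \<open>hom\<close>, reached at \<open>S = {}\<close> by the swap, and the count for the tensor
  product.\<close>

definition mixed_kernel :: "(nat \<Rightarrow> nat \<Rightarrow> real) \<Rightarrow> ('a \<Rightarrow> 'f) \<Rightarrow> 'f set \<Rightarrow> 'a \<Rightarrow> 'a \<Rightarrow> nat \<times> nat \<Rightarrow> nat \<times> nat \<Rightarrow> real" where
  "mixed_kernel W p S u v = (if p u = p v \<and> p u \<notin> S then straight W else crossed W)"

definition mixed_sum :: "'a set \<Rightarrow> ('a \<Rightarrow> 'a \<Rightarrow> bool) \<Rightarrow> nat \<Rightarrow> (nat \<Rightarrow> nat \<Rightarrow> real) \<Rightarrow> ('a \<Rightarrow> 'f) \<Rightarrow> 'f set \<Rightarrow> real" where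
  "mixed_sum V adj n W p S = (\<Sum>\<chi>\<in>V \<rightarrow>\<^sub>E {..<n} \<times> {..<n}.
     \<Prod>e\<in>edges V adj. pair_weight (\<lambda>u v. mixed_kernel W p S u v (\<chi> u) (\<chi> v)) e)"

context
  fixes n :: nat and W :: "nat \<Rightarrow> nat \<Rightarrow> real"
    and V :: "'a set" and adj :: "'a \<Rightarrow> 'a \<Rightarrow> bool"
    and p :: "'a \<Rightarrow> 'f" and AF :: "'f \<Rightarrow> 'f \<Rightarrow> bool"
  assumes W_sym: "\<And>i j. i < n \<Longrightarrow> j < n \<Longrightarrow> W i j = W j i"
    and W_pos: "\<And>i j. i < n \<Longrightarrow> j < n \<Longrightarrow> 0 < W i j"
    and fin: "finite V"
    and adj_sym: "\<And>u v. adj u v \<Longrightarrow> adj v u"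
    and adj_irrefl: "\<And>u. \<not> adj u u"
    and AF_irrefl: "\<And>i. \<not> AF i i"
    and adj_iff: "\<And>u v. u \<in> V \<Longrightarrow> v \<in> V \<Longrightarrow> adj u v \<longleftrightarrow> (p u = p v \<and> u \<noteq> v) \<or> AF (p u) (p v)"
begin

lemma mixed_kernel_commute:
  assumes "z \<in> {..<n} \<times> {..<n}" "z' \<in> {..<n} \<times> {..<n}"
  shows "mixed_kernel W p S u v z z' = mixed_kernel W p S v u z' z"
  using straight_commute[of n W z z'] crossed_commute[of n W z z'] assms W_sym
  by (auto simp: mixed_kernel_def)

text \<open>With the map \<open>\<rho>\<close> on the other cliques fixed, all vertices of clique
  \<open>i\<close> have the same outside neighbours and therefore the same weight. The sum over the
  clique is thus a \<open>clique_sum\<close>.\<close>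

lemma mixed_sum_split_clique:
  fixes i :: 'f and S :: "'f set"
  defines "C \<equiv> {u\<in>V. p u = i}" and "R \<equiv> {u\<in>V. p u \<noteq> i}"
  shows "mixed_sum V adj n W p S = (\<Sum>\<rho>\<in>R \<rightarrow>\<^sub>E {..<n} \<times> {..<n}.
      (\<Prod>e\<in>edges R adj. pair_weight (\<lambda>u v. mixed_kernel W p S u v (\<rho> u) (\<rho> v)) e)
      * clique_sum ({..<n} \<times> {..<n}) (if i \<in> S then crossed W else straight W) (card C)
          (\<lambda>z. \<Prod>v\<in>{v\<in>R. AF i (p v)}. crossed W z (\<rho> v)))"
proof -
  let ?Y = "{..<n} \<times> {..<n}"
  let ?k = "if i \<in> S then crossed W else straight W"
  let ?N = "{v\<in>R. AF i (p v)}"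
  have V: "V = C \<union> R" and disj: "C \<inter> R = {}" and finCR: "finite C" "finite R"
    using fin by (auto simp: C_def R_def)
  have summand: "(\<Prod>e\<in>edges V adj. pair_weight (\<lambda>u v. mixed_kernel W p S u v
          (if u \<in> C then \<kappa> u else \<rho> u) (if v \<in> C then \<kappa> v else \<rho> v)) e)
      = (\<Prod>e\<in>edges R adj. pair_weight (\<lambda>u v. mixed_kernel W p S u v (\<rho> u) (\<rho> v)) e)
        * ((\<Prod>u\<in>C. \<Prod>v\<in>?N. crossed W (\<kappa> u) (\<rho> v))
          * (\<Prod>e\<in>edges C adj. pair_weight (\<lambda>u v. ?k (\<kappa> u) (\<kappa> v)) e))"
    if \<rho>: "\<rho> \<in> R \<rightarrow>\<^sub>E ?Y" and \<kappa>: "\<kappa> \<in> C \<rightarrow>\<^sub>E ?Y" for \<rho> \<kappa>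
  proof -
    define \<chi> where "\<chi> u = (if u \<in> C then \<kappa> u else \<rho> u)" for u
    have \<chi>: "\<chi> u \<in> ?Y" if "u \<in> V" for u
      using that \<rho> \<kappa> by (auto simp: \<chi>_def V PiE_iff)
    have \<chi>C: "\<chi> u = \<kappa> u" if "u \<in> C" for u using that by (simp add: \<chi>_def)
    have \<chi>R: "\<chi> u = \<rho> u" if "u \<in> R" for u using that disj by (auto simp: \<chi>_def)
    let ?g = "\<lambda>u v. mixed_kernel W p S u v (\<chi> u) (\<chi> v)"
    have "(\<Prod>e\<in>edges V adj. pair_weight ?g e)
        = (\<Prod>e\<in>edges C adj. pair_weight ?g e) * (\<Prod>e\<in>edges R adj. pair_weight ?g e)
          * (\<Prod>u\<in>C. \<Prod>v\<in>{v\<in>R. adj u v}. ?g u v)"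
      unfolding V
    proof (rule prod_edges_Un[OF finCR disj adj_sym])
      show "?g u v = ?g v u" if "u \<in> C" "v \<in> R" for u v
        using that \<chi> by (intro mixed_kernel_commute) (auto simp: V)
    qed
    also have "(\<Prod>e\<in>edges C adj. pair_weight ?g e)
        = (\<Prod>e\<in>edges C adj. pair_weight (\<lambda>u v. ?k (\<kappa> u) (\<kappa> v)) e)"
    proof (intro prod.cong refl pair_weight_cong[where V = C and adj = adj])
      fix u v assume "u \<in> C" "v \<in> C"
      then show "?g u v = ?k (\<kappa> u) (\<kappa> v)"
        unfolding \<chi>C[OF \<open>u \<in> C\<close>] \<chi>C[OF \<open>v \<in> C\<close>] by (simp add: mixed_kernel_def C_def)
    qed
    also have "(\<Prod>e\<in>edges R adj. pair_weight ?g e)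
        = (\<Prod>e\<in>edges R adj. pair_weight (\<lambda>u v. mixed_kernel W p S u v (\<rho> u) (\<rho> v)) e)"
      by (intro prod.cong refl pair_weight_cong[where V = R and adj = adj]) (simp_all add: \<chi>R)
    also have "(\<Prod>u\<in>C. \<Prod>v\<in>{v\<in>R. adj u v}. ?g u v) = (\<Prod>u\<in>C. \<Prod>v\<in>?N. crossed W (\<kappa> u) (\<rho> v))"
    proof (intro prod.cong refl)
      fix u assume u: "u \<in> C"
      then show "{v\<in>R. adj u v} = ?N"
        using adj_iff by (auto simp: C_def R_def)
      fix v assume "v \<in> ?N"
      then show "?g u v = crossed W (\<kappa> u) (\<rho> v)"
        using u \<chi>C[OF u] \<chi>R[of v] by (auto simp: mixed_kernel_def C_def R_def)
    qed
    finally show ?thesis by (simp add: \<chi>_def mult_ac)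
  qed
  have clique: "(\<Sum>\<kappa>\<in>C \<rightarrow>\<^sub>E ?Y. (\<Prod>u\<in>C. \<gamma> (\<kappa> u))
        * (\<Prod>e\<in>edges C adj. pair_weight (\<lambda>u v. ?k (\<kappa> u) (\<kappa> v)) e))
      = clique_sum ?Y ?k (card C) \<gamma>" for \<gamma>
  proof (rule sum_complete_graph[OF finCR(1) _ adj_sym])
    show "adj u v \<longleftrightarrow> u \<noteq> v" if "u \<in> C" "v \<in> C" for u v
      using that adj_iff[of u v] AF_irrefl by (auto simp: C_def)
    show "?k z z' = ?k z' z" if "z \<in> ?Y" "z' \<in> ?Y" for z z'
      using straight_commute[of n W z z'] crossed_commute[of n W z z'] that W_sym by auto
  qed
  have "mixed_sum V adj n W p S = (\<Sum>\<rho>\<in>R \<rightarrow>\<^sub>E ?Y. \<Sum>\<kappa>\<in>C \<rightarrow>\<^sub>E ?Y.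
      (\<Prod>e\<in>edges V adj. pair_weight (\<lambda>u v. mixed_kernel W p S u v
          (if u \<in> C then \<kappa> u else \<rho> u) (if v \<in> C then \<kappa> v else \<rho> v)) e))"
    unfolding mixed_sum_def by (subst (1) V, rule sum_PiE_Un[OF disj])
  also have "\<dots> = (\<Sum>\<rho>\<in>R \<rightarrow>\<^sub>E ?Y.
      (\<Prod>e\<in>edges R adj. pair_weight (\<lambda>u v. mixed_kernel W p S u v (\<rho> u) (\<rho> v)) e)
      * (\<Sum>\<kappa>\<in>C \<rightarrow>\<^sub>E ?Y. (\<Prod>u\<in>C. \<Prod>v\<in>?N. crossed W (\<kappa> u) (\<rho> v))
          * (\<Prod>e\<in>edges C adj. pair_weight (\<lambda>u v. ?k (\<kappa> u) (\<kappa> v)) e)))"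
    unfolding sum_distrib_left by (intro sum.cong refl summand)
  also have "\<dots> = (\<Sum>\<rho>\<in>R \<rightarrow>\<^sub>E ?Y.
      (\<Prod>e\<in>edges R adj. pair_weight (\<lambda>u v. mixed_kernel W p S u v (\<rho> u) (\<rho> v)) e)
      * clique_sum ?Y ?k (card C) (\<lambda>z. \<Prod>v\<in>?N. crossed W z (\<rho> v)))"
    by (intro sum.cong refl arg_cong2[where f = "(*)"] clique)
  finally show ?thesis .
qed

text \<open>The comparison is made for each \<open>\<rho>\<close> separately: the factor from the
  other cliques is nonnegative and unaffected by \<open>i\<close>, and the clique factor grows by
  \<open>clique_sum_straight_le_crossed\<close>.\<close>

lemma mixed_sum_insert:
  assumes lor: "lorentzian n W" and "i \<notin> S"
  shows "mixed_sum V adj n W p S \<le> mixed_sum V adj n W p (insert i S)"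
proof -
  let ?Y = "{..<n} \<times> {..<n}"
  let ?R = "{u\<in>V. p u \<noteq> i}"
  let ?N = "{v\<in>?R. AF i (p v)}"
  have same: "(\<Prod>e\<in>edges ?R adj. pair_weight (\<lambda>u v. mixed_kernel W p (insert i S) u v (\<rho> u) (\<rho> v)) e)
      = (\<Prod>e\<in>edges ?R adj. pair_weight (\<lambda>u v. mixed_kernel W p S u v (\<rho> u) (\<rho> v)) e)" for \<rho>
    by (intro prod.cong refl pair_weight_cong) (auto simp: mixed_kernel_def)
  show ?thesis
    unfolding mixed_sum_split_clique[where i = i] same
  proof (intro sum_mono mult_left_mono)
    fix \<rho> assume \<rho>: "\<rho> \<in> ?R \<rightarrow>\<^sub>E ?Y"
    then have lt: "fst (\<rho> v) < n" "snd (\<rho> v) < n" if "v \<in> ?R" for v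
      using that by (auto simp: PiE_iff mem_Times_iff)
    show "0 \<le> (\<Prod>e\<in>edges ?R adj. pair_weight (\<lambda>u v. mixed_kernel W p S u v (\<rho> u) (\<rho> v)) e)"
    proof (intro prod_nonneg)
      fix e assume "e \<in> edges ?R adj"
      then obtain u v where uv: "u \<in> ?R" "v \<in> ?R"
        and eq: "pair_weight (\<lambda>u v. mixed_kernel W p S u v (\<rho> u) (\<rho> v)) e = mixed_kernel W p S u v (\<rho> u) (\<rho> v)"
        by (rule pair_weight_obtain) auto
      show "0 \<le> pair_weight (\<lambda>u v. mixed_kernel W p S u v (\<rho> u) (\<rho> v)) e"
        unfolding eq using lt[OF uv(1)] lt[OF uv(2)] W_pos
        by (auto simp: mixed_kernel_def straight_def crossed_def less_imp_le)
    qed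
    \<comment> \<open>The common weight of the clique vertices splits into a function of each
      coordinate, the shape that the clique inequality requires.\<close>
    have crossed: "(\<lambda>z. \<Prod>v\<in>?N. crossed W z (\<rho> v))
        = (\<lambda>z. (\<Prod>v\<in>?N. W (fst z) (snd (\<rho> v))) * (\<Prod>v\<in>?N. W (snd z) (fst (\<rho> v))))"
      by (simp add: crossed_def prod.distrib)
    have "clique_sum ?Y (straight W) (card {u\<in>V. p u = i}) (\<lambda>z. \<Prod>v\<in>?N. crossed W z (\<rho> v))
        \<le> clique_sum ?Y (crossed W) (card {u\<in>V. p u = i}) (\<lambda>z. \<Prod>v\<in>?N. crossed W z (\<rho> v))"
      unfolding crossed
    proof (rule clique_sum_straight_le_crossed[OF W_sym W_pos lor,
          where a = "\<lambda>x. \<Prod>v\<in>?N. W x (snd (\<rho> v))" and b = "\<lambda>y. \<Prod>v\<in>?N. W y (fst (\<rho> v))"])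
      fix x assume x: "x < n"
      show "0 < (\<Prod>v\<in>?N. W x (snd (\<rho> v)))" "0 < (\<Prod>v\<in>?N. W x (fst (\<rho> v)))"
        using W_pos[OF x] lt by (auto intro!: prod_pos)
    qed
    then show "clique_sum ?Y (if i \<in> S then crossed W else straight W) (card {u\<in>V. p u = i})
          (\<lambda>z. \<Prod>v\<in>?N. crossed W z (\<rho> v))
        \<le> clique_sum ?Y (if i \<in> insert i S then crossed W else straight W) (card {u\<in>V. p u = i})
          (\<lambda>z. \<Prod>v\<in>?N. crossed W z (\<rho> v))"
      using \<open>i \<notin> S\<close> by simp
  qed
qed

text \<open>The bipartite swapping trick: exchanging the two coordinates on one side of the bipartition
  turns the straight edges between different cliques into crossed ones.\<close>

lemma mixed_sum_empty:
  assumes A: "\<And>i j. AF i j \<Longrightarrow> i \<in> A \<longleftrightarrow> j \<notin> A"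
  shows "mixed_sum V adj n W p {} = (hom V adj n W)\<^sup>2"
proof -
  let ?Y = "{..<n} \<times> {..<n}"
  define sw where "sw \<chi> = (\<lambda>u\<in>V. if p u \<in> A then prod.swap (\<chi> u) else \<chi> u)" for \<chi> :: "'a \<Rightarrow> nat \<times> nat"
  have sw_sw: "sw (sw \<chi>) = \<chi>" and sw_in: "sw \<chi> \<in> V \<rightarrow>\<^sub>E ?Y" if "\<chi> \<in> V \<rightarrow>\<^sub>E ?Y" for \<chi>
    using that by (auto simp: sw_def PiE_iff extensional_def fun_eq_iff mem_Times_iff)
  have "mixed_sum V adj n W p {}
      = (\<Sum>\<chi>\<in>V \<rightarrow>\<^sub>E ?Y. \<Prod>e\<in>edges V adj. pair_weight (\<lambda>u v. straight W (\<chi> u) (\<chi> v)) e)"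
    unfolding mixed_sum_def
  proof (rule sum.reindex_bij_witness[where j = sw and i = sw])
    fix \<chi> assume \<chi>: "\<chi> \<in> V \<rightarrow>\<^sub>E ?Y"
    show "(\<Prod>e\<in>edges V adj. pair_weight (\<lambda>u v. straight W (sw \<chi> u) (sw \<chi> v)) e)
        = (\<Prod>e\<in>edges V adj. pair_weight (\<lambda>u v. mixed_kernel W p {} u v (\<chi> u) (\<chi> v)) e)"
    proof (intro prod.cong refl pair_weight_cong)
      fix u v assume uv: "u \<in> V" "v \<in> V" and "adj u v \<or> adj v u"
      then have "adj u v" using adj_sym by blast
      then have "p u = p v \<or> AF (p u) (p v)" using adj_iff uv by blast
      \<comment> \<open>Within a clique both ends are swapped or neither is, which preserves
        \<open>straight\<close>; between adjacent cliques exactly one end is swapped.\<close>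
      then show "straight W (sw \<chi> u) (sw \<chi> v) = mixed_kernel W p {} u v (\<chi> u) (\<chi> v)"
        using A[of "p u" "p v"] AF_irrefl uv
        by (auto simp: sw_def mixed_kernel_def straight_def crossed_def)
    qed
  qed (use sw_sw sw_in in auto)
  then show ?thesis by (simp add: hom_square)
qed

lemma hom_square_le_hom_tensor_of_pos:
  assumes lor: "lorentzian n W" and A: "\<And>i j. AF i j \<Longrightarrow> i \<in> A \<longleftrightarrow> j \<notin> A"
  shows "(hom V adj n W)\<^sup>2 \<le> hom (tensor_K2_verts V) (tensor_K2_adj adj) n W"
proof -
  have mono: "mixed_sum V adj n W p {} \<le> mixed_sum V adj n W p S" if "finite S" for S
    using that
  proof (induction S rule: finite_induct)
    case (insert i S)
    then show ?case using mixed_sum_insert[OF lor] order_trans by blast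
  qed simp
  have "(hom V adj n W)\<^sup>2 = mixed_sum V adj n W p {}"
    using mixed_sum_empty[OF A] by simp
  \<comment> \<open>Once \<open>S\<close> contains the index of every clique, no straight edge is
    left.\<close>
  also have "\<dots> \<le> mixed_sum V adj n W p (p ` V)"
    using fin by (intro mono) simp
  also have "\<dots> = (\<Sum>\<chi>\<in>V \<rightarrow>\<^sub>E {..<n} \<times> {..<n}. \<Prod>e\<in>edges V adj. pair_weight (\<lambda>u v. crossed W (\<chi> u) (\<chi> v)) e)"
    unfolding mixed_sum_def
    by (intro sum.cong prod.cong refl pair_weight_cong) (auto simp: mixed_kernel_def)
  also have "\<dots> = hom (tensor_K2_verts V) (tensor_K2_adj adj) n W"
    using W_sym fin adj_sym adj_irrefl by (intro hom_tensor_K2[symmetric]) auto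
  finally show ?thesis .
qed

end

section \<open>Perturbation to positive weights and passage to the limit\<close>

text \<open>Conjugation by \<open>I + \<epsilon> J\<close>, where \<open>J\<close> is the all-ones matrix, preserves the
  reverse Cauchy--Schwarz inequality and makes every entry of a nonzero matrix positive.\<close>

lemma lorentzian_positive_perturbation:
  assumes sym: "\<And>i j. i < n \<Longrightarrow> j < n \<Longrightarrow> W i j = W j i"
    and nonneg: "\<And>i j. i < n \<Longrightarrow> j < n \<Longrightarrow> 0 \<le> W i j"
    and lor: "lorentzian n W"
  obtains P :: "real \<Rightarrow> nat \<Rightarrow> nat \<Rightarrow> real" where
    "\<And>\<epsilon> i j. 0 < \<epsilon> \<Longrightarrow> i < n \<Longrightarrow> j < n \<Longrightarrow> P \<epsilon> i j = P \<epsilon> j i"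
    "\<And>\<epsilon> i j. 0 < \<epsilon> \<Longrightarrow> i < n \<Longrightarrow> j < n \<Longrightarrow> 0 < P \<epsilon> i j"
    "\<And>\<epsilon>. 0 < \<epsilon> \<Longrightarrow> lorentzian n (P \<epsilon>)"
    "\<And>i j. i < n \<Longrightarrow> j < n \<Longrightarrow> ((\<lambda>\<epsilon>. P \<epsilon> i j) \<longlongrightarrow> W i j) (at_right 0)"
proof (cases "\<forall>i<n. \<forall>j<n. W i j = 0")
  \<comment> \<open>Conjugation would leave the zero matrix unchanged. Constant matrices replace it;
    they have rank at most one and give equality in the Lorentzian condition.\<close>
  case True
  have "bform n (\<lambda>_ _. \<epsilon>) x y = \<epsilon> * sum x {..<n} * sum y {..<n}" for \<epsilon> x y
    by (simp add: bform_def sum_distrib_left sum_distrib_right mult_ac)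
  then have "lorentzian n (\<lambda>_ _. \<epsilon>)" for \<epsilon>
    by (simp add: lorentzian_def power2_eq_square mult_ac)
  moreover have "((\<lambda>\<epsilon>. \<epsilon>) \<longlongrightarrow> W i j) (at_right 0)" if "i < n" "j < n" for i j
    using True that by (simp add: tendsto_ident_at)
  ultimately show ?thesis by (intro that[of "\<lambda>\<epsilon> _ _. \<epsilon>"]) auto
next
  case False
  then obtain a b where ab: "a < n" "b < n" "W a b \<noteq> 0" by blast
  \<comment> \<open>\<open>B \<epsilon> i\<close> is row \<open>i\<close> of I + \<epsilon> J. Every
    entry of the conjugate \<open>P \<epsilon>\<close> then contains a positive multiple of the
    nonzero entry \<open>W a b\<close>.\<close>
  define B where "B \<epsilon> i k = (if i = k then 1 else 0) + (\<epsilon> :: real)" for \<epsilon> and i k :: nat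
  define P where "P \<epsilon> i j = bform n W (B \<epsilon> i) (B \<epsilon> j)" for \<epsilon> i j
  have "P \<epsilon> i j = P \<epsilon> j i" for \<epsilon> i j
    unfolding P_def using sym by (intro bform_commute) auto
  moreover have "0 < P \<epsilon> i j" if \<epsilon>: "0 < \<epsilon>" and "i < n" "j < n" for \<epsilon> i j
  proof -
    have B: "0 < B \<epsilon> i k" for i k using \<epsilon> by (simp add: B_def)
    have "0 < B \<epsilon> i a * W a b * B \<epsilon> j b"
      using B[of i a] B[of j b] nonneg[OF ab(1,2)] ab(3) by simp
    also have "\<dots> \<le> (\<Sum>l<n. B \<epsilon> i a * W a l * B \<epsilon> j l)"
      using ab B nonneg by (intro member_le_sum) (auto simp: less_imp_le)
    also have "\<dots> \<le> P \<epsilon> i j"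
      unfolding P_def bform_def using ab B nonneg
      by (intro member_le_sum[where f = "\<lambda>k. \<Sum>l<n. B \<epsilon> i k * W k l * B \<epsilon> j l"] sum_nonneg)
        (auto simp: less_imp_le)
    finally show ?thesis .
  qed
  moreover have "lorentzian n (P \<epsilon>)" if \<epsilon>: "0 < \<epsilon>" for \<epsilon>
  proof -
    define T where "T x k = (\<Sum>i<n. x i * B \<epsilon> i k)" for x k
    have form: "bform n (P \<epsilon>) x y = bform n W (T x) (T y)" for x y
    proof -
      have "bform n (P \<epsilon>) x y = (\<Sum>i<n. x i * (\<Sum>j<n. y j * bform n W (B \<epsilon> i) (B \<epsilon> j)))"
        by (simp add: bform_def[of n "P \<epsilon>"] P_def sum_distrib_left mult_ac)
      also have "\<dots> = (\<Sum>i<n. x i * bform n W (B \<epsilon> i) (T y))"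
      proof (intro sum.cong refl arg_cong2[where f = "(*)"])
        fix i
        have "bform n W (B \<epsilon> i) (T y) = (\<Sum>k<n. \<Sum>l<n. \<Sum>j<n. y j * (B \<epsilon> i k * W k l * B \<epsilon> j l))"
          by (simp add: bform_def T_def sum_distrib_left mult_ac)
        also have "\<dots> = (\<Sum>k<n. \<Sum>j<n. \<Sum>l<n. y j * (B \<epsilon> i k * W k l * B \<epsilon> j l))"
          by (intro sum.cong refl sum.swap)
        also have "\<dots> = (\<Sum>j<n. \<Sum>k<n. \<Sum>l<n. y j * (B \<epsilon> i k * W k l * B \<epsilon> j l))"
          by (rule sum.swap)
        finally show "(\<Sum>j<n. y j * bform n W (B \<epsilon> i) (B \<epsilon> j)) = bform n W (B \<epsilon> i) (T y)"
          by (simp add: bform_def sum_distrib_left)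
      qed
      also have "\<dots> = (\<Sum>i<n. \<Sum>k<n. x i * B \<epsilon> i k * mvec n W (T y) k)"
        by (simp add: bform_mvec sum_distrib_left mult_ac)
      also have "\<dots> = (\<Sum>k<n. \<Sum>i<n. x i * B \<epsilon> i k * mvec n W (T y) k)"
        by (rule sum.swap)
      also have "\<dots> = bform n W (T x) (T y)"
        by (simp add: bform_mvec T_def sum_distrib_right)
      finally show ?thesis .
    qed
    \<comment> \<open>\<open>T\<close> is multiplication by I + \<epsilon> J, so positive test
      vectors stay positive and the inequality for \<open>W\<close> applies to their images.\<close>
    have "0 < T y k" if "\<forall>i<n. 0 < y i" "k < n" for y k
      unfolding T_def using that \<epsilon> by (intro sum_pos) (auto simp: B_def)
    then show ?thesis
      using lor unfolding lorentzian_def form by blast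
  qed
  moreover have "((\<lambda>\<epsilon>. P \<epsilon> i j) \<longlongrightarrow> W i j) (at_right 0)" if "i < n" "j < n" for i j
  proof -
    have "((\<lambda>\<epsilon>. P \<epsilon> i j) \<longlongrightarrow> P 0 i j) (at_right 0)"
      unfolding P_def bform_def B_def by (intro tendsto_intros)
    also have "P 0 i j = (\<Sum>k<n. if k = i then (\<Sum>l<n. if l = j then W i j else 0) else 0)"
      unfolding P_def bform_def B_def
    proof (intro sum.cong refl)
      fix k
      have "(\<Sum>l<n. ((if i = k then 1 else 0) + 0) * W k l * ((if j = l then 1 else 0) + 0))
          = (\<Sum>l<n. if l = j then (if k = i then W i j else 0) else 0)"
        by (intro sum.cong) auto
      then show "(\<Sum>l<n. ((if i = k then 1 else 0) + 0) * W k l * ((if j = l then 1 else 0) + 0))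
          = (if k = i then (\<Sum>l<n. if l = j then W i j else 0) else 0)"
        using that by simp
    qed
    also have "\<dots> = W i j" using that by simp
    finally show ?thesis .
  qed
  ultimately show ?thesis by (intro that[of P])
qed

lemma tendsto_hom:
  assumes "\<And>i j. i < n \<Longrightarrow> j < n \<Longrightarrow> ((\<lambda>\<epsilon>. P \<epsilon> i j) \<longlongrightarrow> W i j) F"
  shows "((\<lambda>\<epsilon>. hom V adj n (P \<epsilon>)) \<longlongrightarrow> hom V adj n W) F"
  unfolding hom_def edge_weight_eq_pair_weight
proof (intro tendsto_sum tendsto_prod)
  fix \<phi> e assume \<phi>: "\<phi> \<in> V \<rightarrow>\<^sub>E {0..<n}" and "e \<in> edges V adj"
  from this(2) obtain u v where uv: "u \<in> V" "v \<in> V" "\<And>g. pair_weight g e = g u v"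
    by (rule pair_weight_obtain) blast
  show "((\<lambda>\<epsilon>. pair_weight (\<lambda>u v. P \<epsilon> (\<phi> u) (\<phi> v)) e) \<longlongrightarrow> pair_weight (\<lambda>u v. W (\<phi> u) (\<phi> v)) e) F"
    unfolding uv(3) using \<phi> uv(1,2) by (intro assms) (auto simp: PiE_iff)
qed

theorem theorem1p6:
  fixes n :: nat and W :: "nat \<Rightarrow> nat \<Rightarrow> real"
    and VF :: "'f set" and AF :: "'f \<Rightarrow> 'f \<Rightarrow> bool"
    and V :: "'a set" and adj :: "'a \<Rightarrow> 'a \<Rightarrow> bool"
  assumes "antiferromagnetic n W"
    and "simple_graph VF AF" and "bipartite VF AF"
    and "simple_graph V adj" and "complete_blowup VF AF V adj"
  shows "(hom V adj n W)^2 \<le> hom (tensor_K2_verts V) (tensor_K2_adj adj) n W"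
proof -
  obtain p where p: "\<And>u v. u \<in> V \<Longrightarrow> v \<in> V \<Longrightarrow> adj u v \<longleftrightarrow> (p u = p v \<and> u \<noteq> v) \<or> AF (p u) (p v)"
    using assms(5) unfolding complete_blowup_def by blast
  obtain A where A: "\<And>i j. AF i j \<Longrightarrow> i \<in> A \<longleftrightarrow> j \<notin> A"
    using assms(3) unfolding bipartite_def by blast
  have AF: "\<not> AF i i" for i using assms(2) by (auto simp: simple_graph_def)
  have fin: "finite V" and adj: "\<And>u v. adj u v \<Longrightarrow> adj v u" "\<And>u. \<not> adj u u"
    using assms(4) by (auto simp: simple_graph_def)
  have W: "W i j = W j i" "0 \<le> W i j" if "i < n" "j < n" for i j
    using assms(1) that by (auto simp: antiferromagnetic_def weighted_graph_def)
  obtain P :: "real \<Rightarrow> nat \<Rightarrow> nat \<Rightarrow> real" where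
    P: "\<And>\<epsilon> i j. 0 < \<epsilon> \<Longrightarrow> i < n \<Longrightarrow> j < n \<Longrightarrow> P \<epsilon> i j = P \<epsilon> j i"
    "\<And>\<epsilon> i j. 0 < \<epsilon> \<Longrightarrow> i < n \<Longrightarrow> j < n \<Longrightarrow> 0 < P \<epsilon> i j"
    "\<And>\<epsilon>. 0 < \<epsilon> \<Longrightarrow> lorentzian n (P \<epsilon>)"
    "\<And>i j. i < n \<Longrightarrow> j < n \<Longrightarrow> ((\<lambda>\<epsilon>. P \<epsilon> i j) \<longlongrightarrow> W i j) (at_right 0)"
  proof (rule lorentzian_positive_perturbation[of n W])
    show "lorentzian n W" by (rule antiferromagnetic_imp_lorentzian[OF assms(1)])
  qed (use W in \<open>auto intro: that\<close>)
  have "(hom V adj n (P \<epsilon>))\<^sup>2 \<le> hom (tensor_K2_verts V) (tensor_K2_adj adj) n (P \<epsilon>)" if "0 < \<epsilon>" for \<epsilon>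
    by (rule hom_square_le_hom_tensor_of_pos[where p = p and AF = AF and A = A])
      (use P(1,2,3)[OF that] fin adj AF p A in blast)+
  then have "\<forall>\<^sub>F \<epsilon> in at_right 0. (hom V adj n (P \<epsilon>))\<^sup>2 \<le> hom (tensor_K2_verts V) (tensor_K2_adj adj) n (P \<epsilon>)"
    by (auto simp: eventually_at_right_field intro!: exI[of _ 1])
  \<comment> \<open>Both sides depend continuously on the matrix entries, so the weak inequality
    survives as \<epsilon> tends to 0 from the right.\<close>
  with trivial_limit_at_right_real tendsto_hom[of n P W, OF P(4)]
    tendsto_power[OF tendsto_hom[of n P W, OF P(4)]]
  show ?thesis by (rule tendsto_le)
qed

end
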